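(* Let $t=g(x,y)$ be a real analytic solution to the zero mean curvature equation $$(1-g_y^2)g_{xx}+2g_xg_yg_{xy}+(1-g_x^2)g_{yy}=0$$ with $g(o)=0$, where $o=(0,0)$ is a lightlike point satisfying $\nabla B_g(o)=0$, $B_g=1-g_x^2-g_y^2$. Let $\alpha_g$ be the approximation function along a lightlike line segment $L$ (through the origin of $\mathbb{L}^3$) on the graph of $g$. (i) If $g$ is even with respect to the $x$-axis, i.e. $g(-x,y)=g(x,y)$, then the solution $\tilde y=h(\tilde t,\tilde x)=g(i\tilde x,\tilde t)$ to the Born-Infeld equation in $\mathbb{L}^3(\tilde t,\tilde x,\tilde y)$ has the approximation function $\alpha_h=\alpha_g$ along a lightlike line segment $\tilde L$ on its graph lying in $\{(\tilde y,0,\tilde y)\mid\tilde y\in\mathbb{R}\}$ or $\{(-\tilde y,0,\tilde y)\mid\tilde y\in\mathbb{R}\}$. (ii) If $g$ is odd with respect to the $x$-axis, i.e. $g(-x,y)=-g(x,y)$, then the solution $\tilde y=h(\tilde t,\tilde x)=-ig(i\tilde t,\tilde x)$ to the Born-Infeld equation in $\mathbb{L}^3(\tilde t,\tilde x,\tilde y)$ has the approximation function $\alpha_h=i(\alpha_g\circ i)$, i.e. $\alpha_h(s)=i\,\alpha_g(is)$, along a lightlike line segment $\tilde L$ on its graph lying in $\{(\tilde y,0,\tilde y)\mid\tilde y\in\mathbb{R}\}$ or $\{(-\tilde y,0,\tilde y)\mid\tilde y\in\mathbb{R}\}$. Moreover each of $\alpha_g$ and $\alpha_h$ is an odd function, and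 it is one of the types $\alpha^+$, $\alpha^0_{I}$ or $\alpha^-_{I}$. A graph of type $\alpha^+$ (resp. $\alpha^-_{I}$) is transformed to a graph of type $\alpha^-_{I}$ (resp. $\alpha^+$), and a graph of type $\alpha^0_{I}$ is transformed to a graph of type $\alpha^0_{I}$.
   Context: $\mathbb{L}^3(t,x,y)$ is Lorentz-Minkowski 3-space with metric $-(dt)^2+(dx)^2+(dy)^2$. A surface is lightlike at a point if its induced metric is degenerate there; for $t=g(x,y)$ this means $B_g=0$. A lightlike line segment on a surface is a straight segment with null direction contained in the surface and consisting of lightlike points. The Born-Infeld equation is $(1-h_{\tilde t}^2)h_{\tilde x\tilde x}+2h_{\tilde t}h_{\tilde x}h_{\tilde t\tilde x}-(1+h_{\tilde x}^2)h_{\tilde t\tilde t}=0$. Wick rotations: $g$ is real analytic on a (connected) domain containing $o$ and symmetric under $x\mapsto-x$; $g(is,y)$ is obtained, for real $s$ near $0$, by substituting $is$ for $x$ in the Taylor expansion $g(x,y)=\sum_n a_n(y)x^n$ (analytic continuation). In (i), $\tilde t=y$, $\tilde x=x$, $\tilde y=t$; in (ii), $\tilde t=x$, $\tilde x=y$, $\tilde y=t$. Everything is considered locally near the origin. Position of $L$: in case (i), $L$ lies in $\{(y,0,y)\mid y\in\mathbb{R}\}$ or $\{(-y,0,y)\mid y\in\mathbb{R}\}$; in case (ii), in $\{(x,x,0)\mid x\in\mathbb{R}\}$ or $\{(-x,x,0)\mid x\in\mathbb{R}\}$ (points written as $(t,x,y)$). Approximation functions. If a zero mean curvature graph $t=G(x,y)$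 contains a lightlike line segment in $\{(y,0,y)\}$, then near it $G(x,y)=y+\frac{\alpha(y)}{2}x^2+\beta(x,y)x^3$ with $\alpha,\beta$ real analytic, and $\alpha(y)=G_{xx}(0,y)$ is the approximation function. For $g$: in case (i) with $L\subset\{(y,0,y)\}$, $\alpha_g(y)=g_{xx}(0,y)$; in case (ii) with $L\subset\{(x,x,0)\}$, the roles of $x$ and $y$ are exchanged and $\alpha_g(x)=g_{yy}(x,0)$. For $h$ with $\tilde L\subset\{(\tilde y,0,\tilde y)\}$: near $\tilde L$ the graph of $h$ is rewritten as a graph $\tilde t=f(\tilde x,\tilde y)$ and $\alpha_h(\tilde y)=f_{\tilde x\tilde x}(0,\tilde y)$. If the lines lie in the other possible positions (with minus sign), one first replaces $g$ by $-g$ and correspondingly $h$ by $-h$. Types. The approximation function satisfies $\alpha'+\alpha^2+\mu=0$ for a real constant $\mu$. By a homothety one normalizes $\mu\in\{1,0,-1\}$, and the type of the graph along the line is the one of the following that its approximation function then is: $\alpha^+=-\tan(y+c)$, $|c|<\pi/2$ ($\mu=1$); $\alpha^0_{I}=0$, $\alpha^0_{II}=(y+c)^{-1}$, $c\neq0$ ($\mu=0$); $\alpha^-_{I}=\tanh(y+c)$, $c\in\mathbb{R}$, $\alpha^-_{II}=\coth(y+c)$, $c\neq0$, $\alpha^-_{III}=\pm1$ ($\mu=-1$). *)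

theory Defs
  imports "HOL-Analysis.Analysis"
begin

text \<open>Points of Lorentz--Minkowski 3-space are triples with the time coordinate first.\<close>

type_synonym point = "real \<times> real \<times> real"

definition lorentz :: "point \<Rightarrow> point \<Rightarrow> real" where
  "lorentz p q = - (fst p * fst q) + fst (snd p) * fst (snd q) + snd (snd p) * snd (snd q)"

definition pd1 :: "(real \<Rightarrow> real \<Rightarrow> real) \<Rightarrow> real \<Rightarrow> real \<Rightarrow> real" where
  "pd1 F u v = deriv (\<lambda>s. F s v) u"

definition pd2 :: "(real \<Rightarrow> real \<Rightarrow> real) \<Rightarrow> real \<Rightarrow> real \<Rightarrow> real" where
  "pd2 F u v = deriv (\<lambda>s. F u s) v"

definition real_analytic2_on :: "(real \<Rightarrow> real \<Rightarrow> real) \<Rightarrow> (real \<times> real) set \<Rightarrow> bool" where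
  "real_analytic2_on F D \<longleftrightarrow>
     (\<forall>(a, b) \<in> D. \<exists>r > 0. \<exists>c :: nat \<times> nat \<Rightarrow> real. \<forall>u v.
        \<bar>u - a\<bar> < r \<longrightarrow> \<bar>v - b\<bar> < r \<longrightarrow>
        ((\<lambda>(m, n). c (m, n) * (u - a) ^ m * (v - b) ^ n) has_sum F u v) UNIV)"

definition zero_mean_curvature_on :: "(real \<Rightarrow> real \<Rightarrow> real) \<Rightarrow> (real \<times> real) set \<Rightarrow> bool" where
  "zero_mean_curvature_on g D \<longleftrightarrow>
     (\<forall>(x, y) \<in> D.
        (1 - (pd2 g x y)\<^sup>2) * pd1 (pd1 g) x y + 2 * pd1 g x y * pd2 g x y * pd2 (pd1 g) x y
        + (1 - (pd1 g x y)\<^sup>2) * pd2 (pd2 g) x y = 0)"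

text \<open>In \<^term>\<open>h t x\<close> the first argument is the time variable.\<close>

definition born_infeld_on :: "(real \<Rightarrow> real \<Rightarrow> real) \<Rightarrow> (real \<times> real) set \<Rightarrow> bool" where
  "born_infeld_on h D \<longleftrightarrow>
     (\<forall>(t, x) \<in> D.
        (1 - (pd1 h t x)\<^sup>2) * pd2 (pd2 h) t x + 2 * pd1 h t x * pd2 h t x * pd2 (pd1 h) t x
        - (1 + (pd2 h t x)\<^sup>2) * pd1 (pd1 h) t x = 0)"

definition B :: "(real \<Rightarrow> real \<Rightarrow> real) \<Rightarrow> real \<Rightarrow> real \<Rightarrow> real" where
  "B g x y = 1 - (pd1 g x y)\<^sup>2 - (pd2 g x y)\<^sup>2"

text \<open>The parametrized surfaces \<open>t = g(x,y)\<close> and \<open>y = h(t,x)\<close>.\<close>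

definition graph_t :: "(real \<Rightarrow> real \<Rightarrow> real) \<Rightarrow> real \<Rightarrow> real \<Rightarrow> point" where
  "graph_t g x y = (g x y, x, y)"

definition graph_y :: "(real \<Rightarrow> real \<Rightarrow> real) \<Rightarrow> real \<Rightarrow> real \<Rightarrow> point" where
  "graph_y h t x = (t, x, h t x)"

text \<open>The induced metric is degenerate: its Gram determinant \<open>EG - F\<^sup>2\<close> vanishes.\<close>

definition lightlike_at :: "(real \<Rightarrow> real \<Rightarrow> point) \<Rightarrow> real \<Rightarrow> real \<Rightarrow> bool" where
  "lightlike_at X u v \<longleftrightarrow>
     (let Xu = vector_derivative (\<lambda>s. X s v) (at u);
          Xv = vector_derivative (\<lambda>s. X u s) (at v)
      in lorentz Xu Xu * lorentz Xv Xv - (lorentz Xu Xv)\<^sup>2 = 0)"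

lemma lightlike_at_graph_t_iff:
  assumes "(\<lambda>s. g s y) differentiable (at x)" "(\<lambda>s. g x s) differentiable (at y)"
  shows "lightlike_at (graph_t g) x y \<longleftrightarrow> B g x y = 0"
proof -
  have gx: "((\<lambda>s. g s y) has_vector_derivative pd1 g x y) (at x)"
    and gy: "((\<lambda>s. g x s) has_vector_derivative pd2 g x y) (at y)"
    using assms unfolding pd1_def pd2_def
    by (auto simp: has_real_derivative_iff_has_vector_derivative [symmetric]
        DERIV_deriv_iff_real_differentiable)
  have "vector_derivative (\<lambda>s. graph_t g s y) (at x) = (pd1 g x y, 1, 0)"
    unfolding graph_t_def
    by (intro vector_derivative_at has_vector_derivative_Pair gx) (auto intro!: derivative_eq_intros)
  moreover have "vector_derivative (\<lambda>s. graph_t g x s) (at y) = (pd2 g x y, 0, 1)"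
    unfolding graph_t_def
    by (intro vector_derivative_at has_vector_derivative_Pair gy) (auto intro!: derivative_eq_intros)
  ultimately show ?thesis
    by (simp add: lightlike_at_def Let_def lorentz_def B_def power2_eq_square algebra_simps)
qed

definition lightlike_line_segment ::
    "(real \<Rightarrow> real \<Rightarrow> point) \<Rightarrow> (real \<times> real) set \<Rightarrow> point set \<Rightarrow> bool" where
  "lightlike_line_segment X D L \<longleftrightarrow>
     (\<exists>a b. a \<noteq> b \<and> lorentz (b - a) (b - a) = 0 \<and> L = closed_segment a b) \<and>
     L \<subseteq> (\<lambda>(u, v). X u v) ` D \<and>
     (\<forall>(u, v) \<in> D. X u v \<in> L \<longrightarrow> lightlike_at X u v)"

text \<open>
  The value at the complex point \<open>z\<close> of the analytic continuation of a real function \<open>u\<close> that is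
  analytic at \<open>0\<close>, by its Taylor series there.
\<close>

definition taylor_summable :: "(real \<Rightarrow> real) \<Rightarrow> complex \<Rightarrow> bool" where
  "taylor_summable u z \<longleftrightarrow>
     summable (\<lambda>n. complex_of_real ((deriv ^^ n) u 0 / fact n) * z ^ n)"

definition taylor_ext :: "(real \<Rightarrow> real) \<Rightarrow> complex \<Rightarrow> complex" where
  "taylor_ext u z = (\<Sum>n. complex_of_real ((deriv ^^ n) u 0 / fact n) * z ^ n)"

text \<open>\<open>h(t,x) = g(ix,t)\<close>\<close>

definition wick_even_on ::
    "(real \<Rightarrow> real \<Rightarrow> real) \<Rightarrow> (real \<Rightarrow> real \<Rightarrow> real) \<Rightarrow> (real \<times> real) set \<Rightarrow> bool" where
  "wick_even_on g h U \<longleftrightarrow>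
     (\<forall>(t, x) \<in> U.
        taylor_summable (\<lambda>s. g s t) (\<i> * complex_of_real x) \<and>
        complex_of_real (h t x) = taylor_ext (\<lambda>s. g s t) (\<i> * complex_of_real x))"

text \<open>\<open>h(t,x) = -i g(it,x)\<close>\<close>

definition wick_odd_on ::
    "(real \<Rightarrow> real \<Rightarrow> real) \<Rightarrow> (real \<Rightarrow> real \<Rightarrow> real) \<Rightarrow> (real \<times> real) set \<Rightarrow> bool" where
  "wick_odd_on g h U \<longleftrightarrow>
     (\<forall>(t, x) \<in> U.
        taylor_summable (\<lambda>s. g s x) (\<i> * complex_of_real t) \<and>
        complex_of_real (h t x) = - \<i> * taylor_ext (\<lambda>s. g s x) (\<i> * complex_of_real t))"

text \<open>
  Near the origin of 3-space, the surface \<open>y = h(t,x)\<close> is the graph \<open>t = f(x,y)\<close>.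
  Where \<open>\<partial>h/\<partial>t \<noteq> 0\<close> this determines the germ of \<open>f\<close> at the origin, which is analytic if \<open>h\<close> is.
\<close>

definition rewritten_as_t_graph ::
    "(real \<Rightarrow> real \<Rightarrow> real) \<Rightarrow> (real \<Rightarrow> real \<Rightarrow> real) \<Rightarrow> bool" where
  "rewritten_as_t_graph h f \<longleftrightarrow>
     (\<forall>\<^sub>F (t, x, y) in nhds (0, 0, 0). y = h t x \<longleftrightarrow> t = f x y)"

text \<open>
  Approximation function of a graph \<open>t = G(x,y)\<close> whose lightlike line lies in \<open>{(y,0,y)}\<close>.
\<close>

definition approx_fun :: "(real \<Rightarrow> real \<Rightarrow> real) \<Rightarrow> real \<Rightarrow> real" where
  "approx_fun G y = pd1 (pd1 G) 0 y"

text \<open>The image of the graph of \<open>G\<close> under the homothety with factor \<open>k\<close>.\<close>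

definition homothety :: "real \<Rightarrow> (real \<Rightarrow> real \<Rightarrow> real) \<Rightarrow> real \<Rightarrow> real \<Rightarrow> real" where
  "homothety k G x y = k * G (x / k) (y / k)"

definition of_type :: "(real \<Rightarrow> real \<Rightarrow> real) \<Rightarrow> (real \<Rightarrow> real) set \<Rightarrow> bool" where
  "of_type G A \<longleftrightarrow>
     (\<exists>k > 0. \<exists>\<alpha> \<in> A. \<forall>\<^sub>F y in nhds 0. approx_fun (homothety k G) y = \<alpha> y)"

definition alpha_plus :: "(real \<Rightarrow> real) set" where
  "alpha_plus = {\<lambda>y. - tan (y + c) | c. \<bar>c\<bar> < pi / 2}"

definition alpha_zero_I :: "(real \<Rightarrow> real) set" where
  "alpha_zero_I = {\<lambda>y. 0}"

definition alpha_minus_I :: "(real \<Rightarrow> real) set" where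
  "alpha_minus_I = {\<lambda>y. tanh (y + c) | c. True}"

definition odd_near_0 :: "(real \<Rightarrow> real) \<Rightarrow> bool" where
  "odd_near_0 u \<longleftrightarrow> (\<forall>\<^sub>F s in nhds 0. u (- s) = - u s)"

end

theory Submission
  imports Defs "HOL-Complex_Analysis.Conformal_Mappings"
begin

text \<open>
  Everything is expressed through one double power series. Near the origin
  \<open>g(x,y) = \<Sum> c(m,n) x\<^sup>m y\<^sup>n\<close> converges absolutely on a square, so the same coefficients define a
  holomorphic function of complex arguments, and a Wick rotation evaluates it at \<open>\<i>x\<close>. If \<open>g\<close> is
  even in \<open>x\<close>, only even \<open>m\<close> occur and \<open>\<i>\<^sup>m\<close> is real; if \<open>g\<close> is odd, only odd \<open>m\<close> occur and
  \<open>-\<i> \<i>\<^sup>m\<close> is real. Hence the rotated function \<open>h\<close> is again a real double power series, and its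
  partial derivatives are those of \<open>g\<close> at \<open>(\<i>x,y)\<close> times powers of \<open>\<i>\<close> (\<open>wick_psum\<close>, \<open>wick_d1\<close>).
  The zero mean curvature operator of \<open>g\<close> is holomorphic in \<open>x\<close> and vanishes for real \<open>x\<close>, hence
  also at \<open>\<i>x\<close> (\<open>zmc_op_complex\<close>); there it is, up to a unit factor, the Born-Infeld operator
  of \<open>h\<close>.

  The position of \<open>L\<close> comes from the gradient at the origin. If the null direction of \<open>L\<close> is
  \<open>(\<tau>,p,q)\<close>, then \<open>g\<^sub>x p + g\<^sub>y q = \<tau>\<close>, \<open>p\<^sup>2 + q\<^sup>2 = \<tau>\<^sup>2\<close> and, the origin being lightlike,
  \<open>g\<^sub>x\<^sup>2 + g\<^sub>y\<^sup>2 = 1\<close>. So \<open>(p,q)\<close> is parallel to the gradient. Parity kills \<open>g\<^sub>x\<close> (even case) or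
  \<open>g\<^sub>y\<close> (odd case), and the remaining partial derivative is the sign \<open>\<sigma>\<close> of the statement.

  After multiplication by \<open>\<sigma>\<close> the rotated surface \<open>y = H(t,x)\<close> satisfies \<open>H(t,0) = t\<close> and
  \<open>H\<^sub>x(t,0) = 0\<close>. Solving for \<open>t = f(x,y)\<close> by the inverse function theorem and differentiating
  twice gives \<open>f\<^sub>x\<^sub>x(0,y) = - H\<^sub>x\<^sub>x(y,0)\<close> (\<open>implicit_t_graph\<close>), from which both formulas for
  \<open>\<alpha>\<^sub>h\<close> are read off.

  For the types in the odd case, the second normal derivative of the zero mean curvature equation
  along the line is \<open>\<alpha>'' + 2 \<alpha> \<alpha>' = 0\<close>, so \<open>\<alpha>' + \<alpha>\<^sup>2 + \<mu> = 0\<close> for a constant \<open>\<mu>\<close>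
  (\<open>riccati_along_axis\<close>). Oddness forces \<open>\<alpha>(0) = 0\<close>, and uniqueness for this Riccati equation
  leaves \<open>-k tan(ks)\<close>, \<open>0\<close> or \<open>k tanh(ks)\<close> according to the sign of \<open>\<mu>\<close>. Continuing the Riccati
  equation to imaginary arguments shows that \<open>\<alpha>\<^sub>h(s) = \<i> \<alpha>\<^sub>g(\<i>s)\<close> satisfies it with \<open>-\<mu>\<close>, which
  exchanges \<open>\<alpha>\<^sup>+\<close> with \<open>\<alpha>\<^sup>-\<^sub>I\<close> and fixes \<open>\<alpha>\<^sup>0\<^sub>I\<close>.
\<close>

section \<open>Double power series with real coefficients\<close>

text \<open>
  Absolute convergence on the open square of half-side \<open>r\<close>, stated at nonnegative arguments only
  because these dominate all real and complex arguments of the same modulus.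
\<close>
definition converges :: "(nat \<times> nat \<Rightarrow> real) \<Rightarrow> real \<Rightarrow> bool" where
  "converges c r \<longleftrightarrow> (\<forall>x y. 0 \<le> x \<longrightarrow> x < r \<longrightarrow> 0 \<le> y \<longrightarrow> y < r \<longrightarrow>
     (\<lambda>(m, n). \<bar>c (m, n)\<bar> * x ^ m * y ^ n) summable_on UNIV)"

text \<open>
  Polymorphic, so that one coefficient family has both a real sum and its holomorphic extension.
\<close>
definition psum :: "(nat \<times> nat \<Rightarrow> real) \<Rightarrow> 'a \<Rightarrow> 'a \<Rightarrow> 'a::{real_normed_field,banach}" where
  "psum c x y = (\<Sum>\<^sub>\<infinity>(m, n)\<in>UNIV. of_real (c (m, n)) * x ^ m * y ^ n)"

text \<open>
  The coefficients of the series as a power series in its first variable, the second being fixed.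
\<close>
definition slice :: "(nat \<times> nat \<Rightarrow> real) \<Rightarrow> 'a \<Rightarrow> nat \<Rightarrow> 'a::{real_normed_field,banach}" where
  "slice c y m = (\<Sum>\<^sub>\<infinity>n\<in>UNIV. of_real (c (m, n)) * y ^ n)"

definition d1 :: "(nat \<times> nat \<Rightarrow> real) \<Rightarrow> nat \<times> nat \<Rightarrow> real" where
  "d1 c = (\<lambda>(m, n). real (Suc m) * c (Suc m, n))"

definition d2 :: "(nat \<times> nat \<Rightarrow> real) \<Rightarrow> nat \<times> nat \<Rightarrow> real" where
  "d2 c = (\<lambda>(m, n). real (Suc n) * c (m, Suc n))"

lemma converges_abs_summable:
  fixes x y :: "'a::{real_normed_field,banach}"
  assumes "converges c r" "norm x < r" "norm y < r"
  shows "(\<lambda>(m, n). of_real (c (m, n)) * x ^ m * y ^ n) abs_summable_on UNIV"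
proof -
  have "(\<lambda>(m, n). \<bar>c (m, n)\<bar> * norm x ^ m * norm y ^ n) summable_on UNIV"
    using assms by (auto simp: converges_def)
  then show ?thesis
    by (simp add: case_prod_unfold norm_mult norm_power)
qed

lemma psum_has_sum:
  fixes x y :: "'a::{real_normed_field,banach}"
  assumes "converges c r" "norm x < r" "norm y < r"
  shows "((\<lambda>(m, n). of_real (c (m, n)) * x ^ m * y ^ n) has_sum psum c x y) UNIV"
  unfolding psum_def
  using abs_summable_summable[OF converges_abs_summable[OF assms]] by (rule has_sum_infsum)

lemma psumI:
  fixes x y :: "'a::{real_normed_field,banach}"
  assumes "((\<lambda>(m, n). of_real (c (m, n)) * x ^ m * y ^ n) has_sum s) UNIV"
  shows "psum c x y = s"
  unfolding psum_def using assms by (rule infsumI)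

lemma slice_has_sum:
  fixes y :: "'a::{real_normed_field,banach}"
  assumes c: "converges c r" and y: "norm y < r"
  shows "((\<lambda>n. of_real (c (m, n)) * y ^ n) has_sum slice c y m) UNIV"
proof -
  have r: "r > 0" using y norm_ge_zero[of y] by linarith
  define x :: 'a where "x = of_real (r / 2)"
  have x: "norm x < r" "x \<noteq> 0" using r by (auto simp: x_def)
  have "(\<lambda>(m, n). of_real (c (m, n)) * x ^ m * y ^ n) summable_on Pair m ` UNIV"
    by (rule summable_on_subset_banach[OF has_sum_imp_summable[OF psum_has_sum[OF c x(1) y]]]) auto
  then have "(\<lambda>n. (of_real (c (m, n)) * y ^ n) * x ^ m) summable_on UNIV"
    by (subst (asm) summable_on_reindex) (auto simp: inj_on_def o_def mult_ac)
  then have "(\<lambda>n. of_real (c (m, n)) * y ^ n) summable_on UNIV"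
    using x(2) by (subst (asm) summable_on_cmult_left') auto
  then show ?thesis unfolding slice_def by (rule has_sum_infsum)
qed

lemma slice_psum_has_sum:
  fixes x y :: "'a::{real_normed_field,banach}"
  assumes c: "converges c r" and x: "norm x < r" and y: "norm y < r"
  shows "((\<lambda>m. slice c y m * x ^ m) has_sum psum c x y) UNIV"
proof (rule has_sum_SigmaD)
  show "((\<lambda>(m, n). of_real (c (m, n)) * x ^ m * y ^ n) has_sum psum c x y) (UNIV \<times> UNIV)"
    using psum_has_sum[OF assms] by simp
  show "((\<lambda>n. case (m, n) of (m, n) \<Rightarrow> of_real (c (m, n)) * x ^ m * y ^ n) has_sum
          slice c y m * x ^ m) UNIV" for m
    using has_sum_cmult_left[OF slice_has_sum[OF c y, of m], of "x ^ m"]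
    by (simp add: mult_ac)
qed

lemma slice_psum_sums:
  fixes x y :: "'a::{real_normed_field,banach}"
  assumes "converges c r" "norm x < r" "norm y < r"
  shows "(\<lambda>m. slice c y m * x ^ m) sums psum c x y"
  using slice_psum_has_sum[OF assms] by (rule has_sum_imp_sums)

text \<open>
  Interchanging the variables transfers every fact about the first variable to the second.
\<close>
lemma psum_swap: "psum (c \<circ> prod.swap) x y = psum c y x"
proof -
  have "psum (c \<circ> prod.swap) x y =
      (\<Sum>\<^sub>\<infinity>p\<in>UNIV. (\<lambda>(m, n). of_real (c (m, n)) * y ^ m * x ^ n) (prod.swap p))"
    unfolding psum_def by (rule infsum_cong) (auto simp: mult_ac)
  also have "\<dots> = psum c y x"
    unfolding psum_def by (rule infsum_reindex_bij_betw) (rule bij_swap)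
  finally show ?thesis .
qed

lemma converges_swap: "converges c r \<Longrightarrow> converges (c \<circ> prod.swap) r"
proof (unfold converges_def, intro allI impI)
  fix x y :: real
  assume c: "\<forall>x y. 0 \<le> x \<longrightarrow> x < r \<longrightarrow> 0 \<le> y \<longrightarrow> y < r \<longrightarrow>
     (\<lambda>(m, n). \<bar>c (m, n)\<bar> * x ^ m * y ^ n) summable_on UNIV"
    and xy: "0 \<le> x" "x < r" "0 \<le> y" "y < r"
  from c xy have "(\<lambda>(m, n). \<bar>c (m, n)\<bar> * y ^ m * x ^ n) summable_on UNIV" by blast
  then have "(\<lambda>p. (\<lambda>(m, n). \<bar>c (m, n)\<bar> * y ^ m * x ^ n) (prod.swap p)) summable_on UNIV"
    by (subst summable_on_reindex_bij_betw[OF bij_swap])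
  then show "(\<lambda>(m, n). \<bar>(c \<circ> prod.swap) (m, n)\<bar> * x ^ m * y ^ n) summable_on UNIV"
    by (rule summable_on_cong[THEN iffD1, rotated]) (auto simp: mult_ac)
qed

lemma d1_swap: "d1 (c \<circ> prod.swap) = d2 c \<circ> prod.swap"
  and d2_swap: "d2 (c \<circ> prod.swap) = d1 c \<circ> prod.swap"
  by (auto simp: d1_def d2_def fun_eq_iff)

lemma d2_d1_commute: "d2 (d1 c) = d1 (d2 c)"
  by (auto simp: d1_def d2_def fun_eq_iff)

text \<open>
  Differentiation keeps the square of convergence: summed first over \<open>n\<close>, the absolute values form
  a power series in \<open>x\<close>, for which termwise differentiation is known to preserve convergence.
\<close>
lemma converges_d1:
  assumes c: "converges c r" shows "converges (d1 c) r"
  unfolding converges_def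
proof (intro allI impI)
  fix x y :: real assume xy: "0 \<le> x" "x < r" "0 \<le> y" "y < r"
  define a where "a = (\<lambda>p. \<bar>c p\<bar>)"
  have a: "converges a r" using c by (simp add: converges_def a_def)
  have "summable (\<lambda>m. diffs (slice a y) m * x ^ m)"
  proof (rule termdiff_converges)
    show "norm x < r" using xy by simp
    show "summable (\<lambda>m. slice a y m * z ^ m)" if "norm z < r" for z :: real
      using slice_psum_sums[OF a that, of y] xy by (auto simp: sums_iff)
  qed
  moreover have nn: "slice a y m \<ge> 0" for m
    unfolding slice_def by (rule infsum_nonneg) (auto simp: a_def xy)
  ultimately have "(\<lambda>m. diffs (slice a y) m * x ^ m) summable_on UNIV"
    by (subst summable_on_UNIV_nonneg_real_iff) (auto simp: diffs_def xy)
  then have "(\<lambda>(m, n). \<bar>d1 c (m, n)\<bar> * x ^ m * y ^ n) summable_on (UNIV \<times> UNIV)"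
  proof (rule summable_on_SigmaI[rotated])
    fix m
    have "((\<lambda>n. a (Suc m, n) * y ^ n) has_sum slice a y (Suc m)) UNIV"
      using slice_has_sum[OF a, of y "Suc m"] xy by simp
    from has_sum_cmult_right[OF this, of "real (Suc m) * x ^ m"]
    show "((\<lambda>n. case (m, n) of (m, n) \<Rightarrow> \<bar>d1 c (m, n)\<bar> * x ^ m * y ^ n) has_sum
        diffs (slice a y) m * x ^ m) UNIV"
      by (simp add: d1_def diffs_def a_def abs_mult mult_ac)
  qed (auto simp: xy)
  then show "(\<lambda>(m, n). \<bar>d1 c (m, n)\<bar> * x ^ m * y ^ n) summable_on UNIV" by simp
qed

lemma converges_d2: "converges c r \<Longrightarrow> converges (d2 c) r"
proof -
  assume "converges c r"
  then have "converges (d1 (c \<circ> prod.swap) \<circ> prod.swap) r"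
    by (intro converges_swap converges_d1)
  then show ?thesis by (simp add: d1_swap comp_assoc)
qed

lemma slice_d1:
  fixes y :: "'a::{real_normed_field,banach}"
  assumes "converges c r" "norm y < r"
  shows "slice (d1 c) y m = diffs (slice c y) m"
proof -
  have "((\<lambda>n. of_nat (Suc m) * (of_real (c (Suc m, n)) * y ^ n)) has_sum
      of_nat (Suc m) * slice c y (Suc m)) UNIV"
    by (intro has_sum_cmult_right slice_has_sum[OF assms])
  then show ?thesis
    unfolding slice_def[of "d1 c"] diffs_def
    by (intro infsumI) (simp add: d1_def mult_ac)
qed

lemma psum_deriv1:
  fixes x y :: "'a::{real_normed_field,banach}"
  assumes c: "converges c r" and x: "norm x < r" and y: "norm y < r"
  shows "((\<lambda>z. psum c z y) has_field_derivative psum (d1 c) x y) (at x)"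
proof -
  have "((\<lambda>z. \<Sum>m. slice c y m * z ^ m) has_field_derivative (\<Sum>m. diffs (slice c y) m * x ^ m)) (at x)"
    by (rule termdiffs_strong'[OF _ x]) (use slice_psum_sums[OF c _ y] in \<open>auto simp: sums_iff\<close>)
  also have "(\<Sum>m. diffs (slice c y) m * x ^ m) = psum (d1 c) x y"
    using slice_psum_sums[OF converges_d1[OF c] x y]
    by (simp add: slice_d1[OF c y] sums_iff)
  finally show ?thesis
  proof (rule has_field_derivative_transform_within_open)
    show "x \<in> ball 0 r" "open (ball (0::'a) r)" using x by auto
    show "(\<Sum>m. slice c y m * z ^ m) = psum c z y" if "z \<in> ball 0 r" for z
      using slice_psum_sums[OF c _ y, of z] that by (simp add: sums_iff)
  qed
qed

lemma psum_deriv2: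
  fixes x y :: "'a::{real_normed_field,banach}"
  assumes "converges c r" "norm x < r" "norm y < r"
  shows "((\<lambda>z. psum c x z) has_field_derivative psum (d2 c) x y) (at y)"
  using psum_deriv1[OF converges_swap[OF assms(1)] assms(3,2)]
  by (simp add: psum_swap d1_swap)

lemma psum_of_real:
  assumes "converges c r" "\<bar>x\<bar> < r" "\<bar>y\<bar> < r"
  shows "psum c (of_real x) (of_real y) = (of_real (psum c x y) :: 'a::{real_normed_field,banach})"
proof (rule psumI)
  have "((\<lambda>p. of_real ((\<lambda>(m, n). c (m, n) * x ^ m * y ^ n) p) :: 'a) has_sum of_real (psum c x y)) UNIV"
    using psum_has_sum[of c r x y] assms by (intro has_sum_of_real) auto
  then show "((\<lambda>(m, n). of_real (c (m, n)) * of_real x ^ m * of_real y ^ n :: 'a) has_sum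
      of_real (psum c x y)) UNIV"
    by (simp add: case_prod_unfold)
qed

lemma psum_cmult: "psum (\<lambda>p. k * c p) x y = of_real k * psum c x y"
proof -
  have "psum (\<lambda>p. k * c p) x y =
      (\<Sum>\<^sub>\<infinity>p\<in>UNIV. of_real k * (\<lambda>(m, n). of_real (c (m, n)) * x ^ m * y ^ n) p)"
    unfolding psum_def by (rule infsum_cong) (auto simp: mult_ac)
  also have "\<dots> = of_real k * psum c x y"
    unfolding psum_def by (rule infsum_cmult_right')
  finally show ?thesis .
qed

lemma converges_mono:
  assumes "converges c r" "\<And>p. \<bar>e p\<bar> \<le> K * \<bar>c p\<bar>" shows "converges e r"
  unfolding converges_def
proof (intro allI impI)
  fix x y :: real assume xy: "0 \<le> x" "x < r" "0 \<le> y" "y < r"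
  have "(\<lambda>(m, n). \<bar>c (m, n)\<bar> * x ^ m * y ^ n) summable_on UNIV"
    using assms(1) xy by (simp add: converges_def)
  from summable_on_cmult_right[OF this, of K]
  show "(\<lambda>(m, n). \<bar>e (m, n)\<bar> * x ^ m * y ^ n) summable_on UNIV"
  proof (rule summable_on_comparison_test)
    fix p :: "nat \<times> nat"
    obtain m n where p: "p = (m, n)" by force
    have "\<bar>e (m, n)\<bar> * (x ^ m * y ^ n) \<le> K * \<bar>c (m, n)\<bar> * (x ^ m * y ^ n)"
      by (rule mult_right_mono) (use assms(2) xy in auto)
    then show "(case p of (m, n) \<Rightarrow> \<bar>e (m, n)\<bar> * x ^ m * y ^ n)
        \<le> K * (case p of (m, n) \<Rightarrow> \<bar>c (m, n)\<bar> * x ^ m * y ^ n)"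
      by (simp add: p mult_ac)
  qed (auto simp: xy)
qed

lemma converges_cmult: "converges c r \<Longrightarrow> converges (\<lambda>p. k * c p) r"
  by (rule converges_mono[where K = "\<bar>k\<bar>"]) (auto simp: abs_mult)

lemma converges_smaller: "converges c r \<Longrightarrow> s \<le> r \<Longrightarrow> converges c s"
  by (auto simp: converges_def)

lemma powser_taylor:
  fixes f :: "real \<Rightarrow> real"
  assumes "r > 0" and "\<And>s. \<bar>s\<bar> < r \<Longrightarrow> (\<lambda>n. a n * s ^ n) sums f s"
  shows "(deriv ^^ n) f 0 / fact n = a n"
  using assms(2)
proof (induction n arbitrary: f a)
  case 0
  from 0[of 0] have "(\<lambda>n. a n * 0 ^ n) sums f 0" using assms(1) by simp
  then show ?case using powser_sums_zero_iff[of a "f 0"] by simp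
next
  case (Suc n)
  have "(\<lambda>n. diffs a n * s ^ n) sums deriv f s" if s: "\<bar>s\<bar> < r" for s
  proof -
    have sums: "(\<lambda>n. a n * z ^ n) sums f z" if "norm z < r" for z
      using Suc.prems that by simp
    have f: "(f has_field_derivative (\<Sum>n. diffs a n * s ^ n)) (at s)"
    proof (rule has_field_derivative_transform_within_open)
      show "((\<lambda>z. \<Sum>n. a n * z ^ n) has_field_derivative (\<Sum>n. diffs a n * s ^ n)) (at s)"
        by (rule termdiffs_strong'[of r]) (use sums s in \<open>auto simp: sums_iff\<close>)
      show "s \<in> ball 0 r" "open (ball (0::real) r)" using s by auto
      show "(\<Sum>n. a n * z ^ n) = f z" if "z \<in> ball 0 r" for z
        using sums[of z] that by (simp add: sums_iff)
    qed
    have "norm s < r" using s by simp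
    from termdiffs_sums_strong[OF sums f this] DERIV_imp_deriv[OF f] show ?thesis by simp
  qed
  from Suc.IH[OF this] have "(deriv ^^ n) (deriv f) 0 = fact n * (real (Suc n) * a (Suc n))"
    by (simp add: diffs_def field_simps)
  then show ?case by (simp add: funpow_Suc_right del: funpow.simps)
qed

lemma powser_unique:
  fixes f :: "real \<Rightarrow> real"
  assumes "r > 0" "\<And>s. \<bar>s\<bar> < r \<Longrightarrow> (\<lambda>n. a n * s ^ n) sums f s"
    and "\<And>s. \<bar>s\<bar> < r \<Longrightarrow> (\<lambda>n. b n * s ^ n) sums f s"
  shows "a = b"
  using powser_taylor[OF assms(1,2)] powser_taylor[OF assms(1,3)] by (metis ext)

text \<open>
  Uniqueness in two variables is uniqueness in one variable applied first in \<open>x\<close>, which identifies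
  the slices for each \<open>y\<close>, and then in \<open>y\<close>.
\<close>
lemma psum_unique:
  assumes r: "r > 0" and c: "converges c r" and e: "converges e r"
    and eq: "\<And>x y :: real. \<bar>x\<bar> < r \<Longrightarrow> \<bar>y\<bar> < r \<Longrightarrow> psum c x y = psum e x y"
  shows "c = e"
proof -
  have slice: "slice c y = slice e y" if y: "\<bar>y\<bar> < r" for y :: real
  proof (rule powser_unique[OF r])
    fix s :: real assume s: "\<bar>s\<bar> < r"
    show "(\<lambda>n. slice c y n * s ^ n) sums psum c s y"
      using slice_psum_sums[OF c, of s y] s y by simp
    show "(\<lambda>n. slice e y n * s ^ n) sums psum c s y"
      using slice_psum_sums[OF e, of s y] eq[OF s y] s y by simp
  qed
  have "(\<lambda>n. c (m, n)) = (\<lambda>n. e (m, n))" for m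
  proof (rule powser_unique[OF r])
    fix s :: real assume s: "\<bar>s\<bar> < r"
    show "(\<lambda>n. c (m, n) * s ^ n) sums slice c s m"
      using slice_has_sum[OF c, of s m] s by (auto intro: has_sum_imp_sums)
    show "(\<lambda>n. e (m, n) * s ^ n) sums slice c s m"
      using slice_has_sum[OF e, of s m] s slice by (auto intro: has_sum_imp_sums)
  qed
  then show ?thesis by (auto simp: fun_eq_iff)
qed

section \<open>Analyticity and differentiability of double power series\<close>
lemma has_sum_binomial_product:
  fixes a b x y :: real
  shows "((\<lambda>(j, k). (of_nat (m choose j) * x ^ j * a ^ (m - j)) * (of_nat (n choose k) * y ^ k * b ^ (n - k)))
     has_sum ((a + x) ^ m * (b + y) ^ n)) UNIV"
proof (rule has_sum_finite_neutralI)
  show "(a + x) ^ m * (b + y) ^ n = (\<Sum>(j, k)\<in>{..m} \<times> {..n}.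
      (of_nat (m choose j) * x ^ j * a ^ (m - j)) * (of_nat (n choose k) * y ^ k * b ^ (n - k)))"
    unfolding add.commute[of a x] add.commute[of b y] binomial_ring sum_product sum.cartesian_product ..
qed auto

text \<open>
  Expanding \<open>(a + (u - a))\<^sup>m (b + (v - b))\<^sup>n\<close> binomially gives a quadruple series. It converges
  absolutely because its terms in absolute value sum to the original series at
  \<open>(\<bar>a\<bar> + \<bar>u - a\<bar>, \<bar>b\<bar> + \<bar>v - b\<bar>)\<close>, so it may be regrouped by powers of \<open>u - a\<close> and \<open>v - b\<close>.
\<close>
lemma psum_recentre:
  fixes a b :: real
  assumes c: "converges c r"
  shows "\<exists>e. \<forall>u v. \<bar>a\<bar> + \<bar>u - a\<bar> < r \<longrightarrow> \<bar>b\<bar> + \<bar>v - b\<bar> < r \<longrightarrow>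
     ((\<lambda>(j, k). e (j, k) * (u - a) ^ j * (v - b) ^ k) has_sum psum c u v) UNIV"
proof -
  define T where "T = (\<lambda>(j, k) (m, n). c (m, n) * of_nat (m choose j) * a ^ (m - j) * of_nat (n choose k) * b ^ (n - k))"
  define e where "e = (\<lambda>p. \<Sum>\<^sub>\<infinity>q\<in>UNIV. T p q)"
  have "((\<lambda>(j, k). e (j, k) * (u - a) ^ j * (v - b) ^ k) has_sum psum c u v) UNIV"
    if u: "\<bar>a\<bar> + \<bar>u - a\<bar> < r" and v: "\<bar>b\<bar> + \<bar>v - b\<bar> < r" for u v
  proof -
    define F where "F = (\<lambda>(q, (j, k)). T (j, k) q * ((u - a) ^ j * (v - b) ^ k))"
    have abs: "(\<lambda>p. norm (F p)) summable_on UNIV \<times> UNIV"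
    proof (rule summable_on_SigmaI)
      fix q :: "nat \<times> nat"
      obtain m n where q: "q = (m, n)" by force
      have "((\<lambda>p. \<bar>c (m, n)\<bar> * (case p of (j, k) \<Rightarrow> (of_nat (m choose j) * \<bar>u - a\<bar> ^ j * \<bar>a\<bar> ^ (m - j)) *
           (of_nat (n choose k) * \<bar>v - b\<bar> ^ k * \<bar>b\<bar> ^ (n - k))))
         has_sum \<bar>c (m, n)\<bar> * ((\<bar>a\<bar> + \<bar>u - a\<bar>) ^ m * (\<bar>b\<bar> + \<bar>v - b\<bar>) ^ n)) UNIV"
        by (intro has_sum_cmult_right has_sum_binomial_product)
      then show "((\<lambda>p. norm (F (q, p))) has_sum
          (\<lambda>(m, n). \<bar>c (m, n)\<bar> * (\<bar>a\<bar> + \<bar>u - a\<bar>) ^ m * (\<bar>b\<bar> + \<bar>v - b\<bar>) ^ n) q) UNIV"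
        by (simp add: q F_def T_def case_prod_unfold abs_mult power_abs mult_ac)
    next
      show "(\<lambda>(m, n). \<bar>c (m, n)\<bar> * (\<bar>a\<bar> + \<bar>u - a\<bar>) ^ m * (\<bar>b\<bar> + \<bar>v - b\<bar>) ^ n) summable_on UNIV"
        using c u v by (simp add: converges_def)
    qed auto
    then have "F summable_on UNIV \<times> UNIV" by (rule abs_summable_summable)
    then obtain S where S: "(F has_sum S) (UNIV \<times> UNIV)" by (auto simp: summable_on_def)
    have "((\<lambda>(m, n). c (m, n) * u ^ m * v ^ n) has_sum S) UNIV"
    proof (rule has_sum_SigmaD[OF S])
      fix q :: "nat \<times> nat"
      obtain m n where q: "q = (m, n)" by force
      have "((\<lambda>p. c (m, n) * (case p of (j, k) \<Rightarrow> (of_nat (m choose j) * (u - a) ^ j * a ^ (m - j)) *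
           (of_nat (n choose k) * (v - b) ^ k * b ^ (n - k))))
         has_sum c (m, n) * ((a + (u - a)) ^ m * (b + (v - b)) ^ n)) UNIV"
        by (intro has_sum_cmult_right has_sum_binomial_product)
      then show "((\<lambda>p. F (q, p)) has_sum (case q of (m, n) \<Rightarrow> c (m, n) * u ^ m * v ^ n)) UNIV"
        by (simp add: q F_def T_def case_prod_unfold mult_ac)
    qed
    then have S_eq: "S = psum c u v" using psumI[of c u v S] by simp
    have S': "((\<lambda>(p, q). F (q, p)) has_sum S) (UNIV \<times> UNIV)"
      using S by (subst (asm) has_sum_swap)
    have "((\<lambda>(j, k). e (j, k) * (u - a) ^ j * (v - b) ^ k) has_sum S) UNIV"
    proof (rule has_sum_SigmaD[OF S'])
      fix p :: "nat \<times> nat"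
      obtain j k where p: "p = (j, k)" by force
      have "(\<lambda>q. F (q, p)) summable_on UNIV"
        by (rule summable_on_SigmaD1[where f = "\<lambda>p q. F (q, p)" and A = UNIV])
          (use S' in \<open>auto intro: has_sum_imp_summable\<close>)
      then have "((\<lambda>q. F (q, p)) has_sum (\<Sum>\<^sub>\<infinity>q\<in>UNIV. F (q, p))) UNIV" by (rule has_sum_infsum)
      moreover have "(\<Sum>\<^sub>\<infinity>q\<in>UNIV. F (q, p)) = e p * ((u - a) ^ j * (v - b) ^ k)"
        unfolding p F_def e_def by (simp add: infsum_cmult_left')
      ultimately show "((\<lambda>q. case (p, q) of (p, q) \<Rightarrow> F (q, p)) has_sum
          (case p of (j, k) \<Rightarrow> e (j, k) * (u - a) ^ j * (v - b) ^ k)) UNIV"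
        by (simp add: p mult_ac)
    qed
    then show ?thesis by (simp add: S_eq)
  qed
  then show ?thesis by blast
qed

lemma real_analytic2_on_psum:
  assumes "converges c r"
  shows "real_analytic2_on (psum c) ({-r<..<r} \<times> {-r<..<r})"
  unfolding real_analytic2_on_def
proof safe
  fix a b :: real
  assume ab: "a \<in> {-r<..<r}" "b \<in> {-r<..<r}"
  from psum_recentre[OF assms, of a b] obtain e where
    "\<forall>u v. \<bar>a\<bar> + \<bar>u - a\<bar> < r \<longrightarrow> \<bar>b\<bar> + \<bar>v - b\<bar> < r \<longrightarrow>
       ((\<lambda>(j, k). e (j, k) * (u - a) ^ j * (v - b) ^ k) has_sum psum c u v) UNIV"
    by (rule exE)
  note e = this[rule_format]
  show "\<exists>s>0. \<exists>e. \<forall>u v. \<bar>u - a\<bar> < s \<longrightarrow> \<bar>v - b\<bar> < s \<longrightarrow>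
     ((\<lambda>(m, n). e (m, n) * (u - a) ^ m * (v - b) ^ n) has_sum psum c u v) UNIV"
  proof (intro exI conjI allI impI)
    show "min (r - \<bar>a\<bar>) (r - \<bar>b\<bar>) > 0" using ab by auto
    show "((\<lambda>(m, n). e (m, n) * (u - a) ^ m * (v - b) ^ n) has_sum psum c u v) UNIV"
      if "\<bar>u - a\<bar> < min (r - \<bar>a\<bar>) (r - \<bar>b\<bar>)" "\<bar>v - b\<bar> < min (r - \<bar>a\<bar>) (r - \<bar>b\<bar>)" for u v
      using that by (intro e) auto
  qed
qed

lemma psum_bounded:
  assumes c: "converges c r" and s: "0 \<le> s" "s < r"
  shows "\<exists>M\<ge>0. \<forall>x y :: real. \<bar>x\<bar> \<le> s \<longrightarrow> \<bar>y\<bar> \<le> s \<longrightarrow> \<bar>psum c x y\<bar> \<le> M"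
proof -
  define M where "M = (\<Sum>\<^sub>\<infinity>(m, n)\<in>UNIV. \<bar>c (m, n)\<bar> * s ^ m * s ^ n)"
  have sM: "(\<lambda>(m, n). \<bar>c (m, n)\<bar> * s ^ m * s ^ n) summable_on UNIV"
    using c s by (simp add: converges_def)
  have "\<bar>psum c x y\<bar> \<le> M" if xy: "\<bar>x\<bar> \<le> s" "\<bar>y\<bar> \<le> s" for x y :: real
  proof -
    have "norm (\<Sum>\<^sub>\<infinity>(m, n)\<in>UNIV. c (m, n) * x ^ m * y ^ n) \<le> M"
      unfolding M_def
    proof (rule norm_infsum_le[OF has_sum_infsum has_sum_infsum[OF sM]])
      show "(\<lambda>(m, n). c (m, n) * x ^ m * y ^ n) summable_on UNIV"
        using has_sum_imp_summable[OF psum_has_sum[OF c, of x y]] xy s by simp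
      show "norm (case p of (m, n) \<Rightarrow> c (m, n) * x ^ m * y ^ n)
          \<le> (case p of (m, n) \<Rightarrow> \<bar>c (m, n)\<bar> * s ^ m * s ^ n)" for p
      proof -
        obtain m n where p: "p = (m, n)" by force
        have "\<bar>x\<bar> ^ m * \<bar>y\<bar> ^ n \<le> s ^ m * s ^ n"
          using xy s by (intro mult_mono power_mono) auto
        then show ?thesis
          using mult_left_mono[of "\<bar>x\<bar> ^ m * \<bar>y\<bar> ^ n" "s ^ m * s ^ n" "\<bar>c (m, n)\<bar>"]
          by (simp add: p abs_mult power_abs mult.assoc)
      qed
    qed
    then show ?thesis by (simp add: psum_def)
  qed
  moreover have "M \<ge> 0" unfolding M_def by (rule infsum_nonneg) (use s in auto)
  ultimately show ?thesis by auto
qed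

text \<open>
  The partial derivatives are bounded on a smaller closed square, which makes the sum Lipschitz in
  each variable uniformly in the other.
\<close>
lemma psum_isCont:
  fixes x y :: real
  assumes c: "converges c r" and xy: "\<bar>x\<bar> < r" "\<bar>y\<bar> < r"
  shows "isCont (\<lambda>p. psum c (fst p) (snd p)) (x, y)"
proof -
  define s where "s = (max \<bar>x\<bar> \<bar>y\<bar> + r) / 2"
  have s: "\<bar>x\<bar> < s" "\<bar>y\<bar> < s" "0 \<le> s" "s < r" using xy by (auto simp: s_def)
  obtain M where M: "\<And>x y :: real. \<bar>x\<bar> \<le> s \<Longrightarrow> \<bar>y\<bar> \<le> s \<Longrightarrow> \<bar>psum (d1 c) x y\<bar> \<le> M"
    using psum_bounded[OF converges_d1[OF c] s(3,4)] by auto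
  obtain N where N: "\<And>x y :: real. \<bar>x\<bar> \<le> s \<Longrightarrow> \<bar>y\<bar> \<le> s \<Longrightarrow> \<bar>psum (d2 c) x y\<bar> \<le> N"
    using psum_bounded[OF converges_d2[OF c] s(3,4)] by auto
  define V where "V = {-s<..<s}"
  have conv: "convex V" by (simp add: V_def)
  have A: "\<bar>psum c u v - psum c x v\<bar> \<le> M * \<bar>u - x\<bar>" if "u \<in> V" "v \<in> V" for u v
  proof -
    have "norm (psum c u v - psum c x v) \<le> M * norm (u - x)"
    proof (rule field_differentiable_bound[OF conv])
      show "((\<lambda>u. psum c u v) has_field_derivative psum (d1 c) z v) (at z within V)" if "z \<in> V" for z
        using that \<open>v \<in> V\<close> s
        by (intro psum_deriv1[OF c, THEN has_field_derivative_at_within]) (auto simp: V_def)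
      show "norm (psum (d1 c) z v) \<le> M" if "z \<in> V" for z
        using that \<open>v \<in> V\<close> by (auto simp: V_def intro!: M)
    qed (use that s in \<open>auto simp: V_def\<close>)
    then show ?thesis by simp
  qed
  have B: "\<bar>psum c x v - psum c x y\<bar> \<le> N * \<bar>v - y\<bar>" if "v \<in> V" for v
  proof -
    have "norm (psum c x v - psum c x y) \<le> N * norm (v - y)"
    proof (rule field_differentiable_bound[OF conv])
      show "((\<lambda>v. psum c x v) has_field_derivative psum (d2 c) x z) (at z within V)" if "z \<in> V" for z
        using that s by (intro psum_deriv2[OF c, THEN has_field_derivative_at_within]) (auto simp: V_def)
      show "norm (psum (d2 c) x z) \<le> N" if "z \<in> V" for z
        using that s by (auto simp: V_def intro!: N)
    qed (use that s in \<open>auto simp: V_def\<close>)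
    then show ?thesis by simp
  qed
  have "((\<lambda>p. M * \<bar>fst p - x\<bar> + N * \<bar>snd p - y\<bar>) \<longlongrightarrow> M * \<bar>fst (x, y) - x\<bar> + N * \<bar>snd (x, y) - y\<bar>) (at (x, y))"
    by (intro tendsto_intros)
  then have lim: "((\<lambda>p. M * \<bar>fst p - x\<bar> + N * \<bar>snd p - y\<bar>) \<longlongrightarrow> 0) (at (x, y))" by simp
  have "\<forall>\<^sub>F p in at (x, y). p \<in> V \<times> V"
    using s by (intro eventually_at_in_open') (auto simp: V_def open_Times)
  then have "\<forall>\<^sub>F p in at (x, y). norm (psum c (fst p) (snd p) - psum c x y) \<le> M * \<bar>fst p - x\<bar> + N * \<bar>snd p - y\<bar>"
  proof eventually_elim
    case (elim p)
    with A[of "fst p" "snd p"] B[of "snd p"] show ?case by auto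
  qed
  from Lim_null_comparison[OF this lim] show ?thesis
    by (simp add: isCont_def LIM_zero_iff)
qed

lemma psum_has_derivative:
  fixes x y :: real
  assumes c: "converges c r" and xy: "\<bar>x\<bar> < r" "\<bar>y\<bar> < r"
  shows "((\<lambda>p. psum c (fst p) (snd p)) has_derivative
     (\<lambda>h. psum (d1 c) x y * fst h + psum (d2 c) x y * snd h)) (at (x, y))"
proof -
  define V where "V = {-r<..<r}"
  have V: "x \<in> V" "y \<in> V" using xy by (auto simp: V_def)
  have app: "blinfun_apply (blinfun_scaleR_left a) = (*) a" for a :: real
    by (auto simp: fun_eq_iff)
  have "((\<lambda>(x, y). psum c x y) has_derivative
     (\<lambda>(u, v). psum (d1 c) x y * u + blinfun_apply (blinfun_scaleR_left (psum (d2 c) x y)) v)) (at (x, y) within V \<times> V)"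
  proof (rule has_derivative_partialsI[where fy = "\<lambda>x y. blinfun_scaleR_left (psum (d2 c) x y)"])
    show "((\<lambda>x. psum c x y) has_derivative (*) (psum (d1 c) x y)) (at x within V)"
      by (rule has_derivative_at_withinI) (use psum_deriv1[OF c, of x y] xy in \<open>simp add: has_field_derivative_def\<close>)
    show "((\<lambda>y. psum c x y) has_derivative blinfun_apply (blinfun_scaleR_left (psum (d2 c) x y))) (at y within V)"
      if "x \<in> V" "y \<in> V" for x y
      unfolding app
    proof (rule has_derivative_at_withinI)
      have "\<bar>x\<bar> < r" "\<bar>y\<bar> < r" using that by (auto simp: V_def)
      then show "(psum c x has_derivative (*) (psum (d2 c) x y)) (at y)"
        using psum_deriv2[OF c, of x y] by (simp add: has_field_derivative_def)
    qed
    have "isCont (\<lambda>p. blinfun_scaleR_left (psum (d2 c) (fst p) (snd p)) :: real \<Rightarrow>\<^sub>L real) (x, y)"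
      by (intro continuous_intros psum_isCont[OF converges_d2[OF c] xy])
    then show "continuous (at (x, y) within V \<times> V)
        (\<lambda>(x, y). blinfun_scaleR_left (psum (d2 c) x y) :: real \<Rightarrow>\<^sub>L real)"
      by (simp add: case_prod_unfold continuous_at_imp_continuous_at_within)
  qed (use xy in \<open>auto simp: V_def\<close>)
  moreover have "at (x, y) within V \<times> V = at (x, y)"
    using V by (intro at_within_open) (auto simp: V_def open_Times)
  ultimately show ?thesis by (simp add: case_prod_unfold mult.commute)
qed

lemma psum_chain:
  fixes \<phi> \<psi> :: "real \<Rightarrow> real"
  assumes c: "converges c r" and xy: "\<bar>\<phi> s\<bar> < r" "\<bar>\<psi> s\<bar> < r"
    and \<phi>: "(\<phi> has_field_derivative p) (at s)" and \<psi>: "(\<psi> has_field_derivative q) (at s)"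
  shows "((\<lambda>s. psum c (\<phi> s) (\<psi> s)) has_field_derivative
     psum (d1 c) (\<phi> s) (\<psi> s) * p + psum (d2 c) (\<phi> s) (\<psi> s) * q) (at s)"
proof -
  have "((\<lambda>s. (\<phi> s, \<psi> s)) has_derivative (\<lambda>h. (p * h, q * h))) (at s)"
    using \<phi> \<psi> by (intro has_derivative_Pair) (simp_all add: has_field_derivative_def)
  from has_derivative_compose[OF this psum_has_derivative[OF c xy]]
  have "((\<lambda>s. psum c (\<phi> s) (\<psi> s)) has_derivative (\<lambda>h. psum (d1 c) (\<phi> s) (\<psi> s) * (p * h) +
     psum (d2 c) (\<phi> s) (\<psi> s) * (q * h))) (at s)" by simp
  also have "(\<lambda>h. psum (d1 c) (\<phi> s) (\<psi> s) * (p * h) + psum (d2 c) (\<phi> s) (\<psi> s) * (q * h)) =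
     (*) (psum (d1 c) (\<phi> s) (\<psi> s) * p + psum (d2 c) (\<phi> s) (\<psi> s) * q)"
    by (auto simp: fun_eq_iff algebra_simps)
  finally show ?thesis by (simp add: has_field_derivative_def)
qed

text \<open>
  Stated for any \<open>F\<close> that agrees with a series on the square, so that the lemmas can be iterated
  to reach the higher partial derivatives of \<open>F\<close>.
\<close>
lemma pd1_eq_psum:
  assumes c: "converges c r" and F: "\<And>x y. \<bar>x\<bar> < r \<Longrightarrow> \<bar>y\<bar> < r \<Longrightarrow> F x y = psum c x y"
    and xy: "\<bar>x\<bar> < r" "\<bar>y\<bar> < r"
  shows "pd1 F x y = psum (d1 c) x y"
  unfolding pd1_def
proof (rule DERIV_imp_deriv, rule has_field_derivative_transform_within_open)
  show "((\<lambda>s. psum c s y) has_field_derivative psum (d1 c) x y) (at x)"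
    using psum_deriv1[OF c, of x y] xy by simp
  show "open {-r<..<r}" "x \<in> {-r<..<r}" using xy by auto
  show "psum c s y = F s y" if "s \<in> {-r<..<r}" for s using that xy by (intro F[symmetric]) auto
qed

lemma pd2_eq_psum:
  assumes c: "converges c r" and F: "\<And>x y. \<bar>x\<bar> < r \<Longrightarrow> \<bar>y\<bar> < r \<Longrightarrow> F x y = psum c x y"
    and xy: "\<bar>x\<bar> < r" "\<bar>y\<bar> < r"
  shows "pd2 F x y = psum (d2 c) x y"
  unfolding pd2_def
proof (rule DERIV_imp_deriv, rule has_field_derivative_transform_within_open)
  show "((\<lambda>s. psum c x s) has_field_derivative psum (d2 c) x y) (at y)"
    using psum_deriv2[OF c, of x y] xy by simp
  show "open {-r<..<r}" "y \<in> {-r<..<r}" using xy by auto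
  show "psum c x s = F x s" if "s \<in> {-r<..<r}" for s using that xy by (intro F[symmetric]) auto
qed

section \<open>Analytic continuation and Wick rotation\<close>

text \<open>
  The identity theorem in the form used throughout: an identity that is holomorphic in \<open>x\<close> and
  holds for real \<open>x\<close> persists at \<open>\<i>x\<close>.
\<close>
lemma holomorphic_vanishing:
  assumes hol: "F holomorphic_on ball 0 r"
    and F: "\<And>x. \<bar>x\<bar> < r \<Longrightarrow> F (complex_of_real x) = 0"
    and z: "norm z < r"
  shows "F z = 0"
proof (rule analytic_continuation[OF hol])
  have r: "r > 0" using z norm_ge_zero[of z] by linarith
  show "complex_of_real ` {-r<..<r} \<subseteq> ball 0 r" by auto
  show "0 islimpt complex_of_real ` {-r<..<r}"
    unfolding islimpt_approachable
  proof safe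
    fix d :: real assume d: "d > 0"
    show "\<exists>w\<in>complex_of_real ` {-r<..<r}. w \<noteq> 0 \<and> dist w 0 < d"
      by (rule bexI[OF _ imageI[of "min d r / 2"]]) (use d r in auto)
  qed
  show "F w = 0" if "w \<in> complex_of_real ` {-r<..<r}" for w using that F by auto
qed (use z norm_ge_zero[of z] in \<open>auto simp del: norm_ge_zero\<close>)

lemma psum_holomorphic:
  assumes "converges c r" "norm y < r"
  shows "(\<lambda>z. psum c z y) holomorphic_on ball 0 r"
  unfolding holomorphic_on_def field_differentiable_def
proof (intro ballI exI)
  show "((\<lambda>z. psum c z y) has_field_derivative psum (d1 c) z y) (at z within ball 0 r)"
    if "z \<in> ball 0 r" for z
    using that assms by (intro psum_deriv1[OF assms(1), THEN has_field_derivative_at_within]) auto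
qed

text \<open>
  The left-hand side of the zero mean curvature equation for the graph of the series, meaningful at
  complex points as well.
\<close>
definition zmc_op :: "(nat \<times> nat \<Rightarrow> real) \<Rightarrow> 'a \<Rightarrow> 'a \<Rightarrow> 'a::{real_normed_field,banach}" where
  "zmc_op c x y = (1 - (psum (d2 c) x y)\<^sup>2) * psum (d1 (d1 c)) x y
     + 2 * psum (d1 c) x y * psum (d2 c) x y * psum (d2 (d1 c)) x y
     + (1 - (psum (d1 c) x y)\<^sup>2) * psum (d2 (d2 c)) x y"

lemma zmc_op_complex:
  assumes c: "converges c r" and zmc: "\<And>x y :: real. \<bar>x\<bar> < r \<Longrightarrow> \<bar>y\<bar> < r \<Longrightarrow> zmc_op c x y = 0"
    and z: "norm z < r" and y: "\<bar>y\<bar> < r"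
  shows "zmc_op c z (complex_of_real y) = 0"
proof (rule holomorphic_vanishing[OF _ _ z])
  have y': "norm (complex_of_real y) < r" using y by simp
  note conv = c converges_d1 converges_d2
  show "(\<lambda>z. zmc_op c z (complex_of_real y)) holomorphic_on ball 0 r"
    unfolding zmc_op_def
    by (intro holomorphic_intros psum_holomorphic[OF _ y'] conv)
  show "zmc_op c (complex_of_real x) (complex_of_real y) = 0" if x: "\<bar>x\<bar> < r" for x
  proof -
    have R: "psum e (complex_of_real x) (complex_of_real y) = of_real (psum e x y)" if "converges e r" for e
      using psum_of_real[OF that x y] .
    have "zmc_op c (complex_of_real x) (complex_of_real y) = of_real (zmc_op c x y)"
      unfolding zmc_op_def by (simp add: R conv)
    then show ?thesis using zmc[OF x y] by simp
  qed
qed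

text \<open>
  The series \<open>e\<close> is \<open>\<kappa>\<close> times the series \<open>c\<close> evaluated at \<open>(\<i>x,y)\<close>. The phase \<open>\<kappa>\<close> is a parameter
  because differentiating in the rotated variable multiplies it by \<open>\<i>\<close>.
\<close>
definition wick :: "complex \<Rightarrow> (nat \<times> nat \<Rightarrow> real) \<Rightarrow> (nat \<times> nat \<Rightarrow> real) \<Rightarrow> bool" where
  "wick \<kappa> c e \<longleftrightarrow> (\<forall>m n. complex_of_real (e (m, n)) = \<kappa> * \<i> ^ m * complex_of_real (c (m, n)))"

lemma wick_d1: "wick \<kappa> c e \<Longrightarrow> wick (\<kappa> * \<i>) (d1 c) (d1 e)"
  and wick_d2: "wick \<kappa> c e \<Longrightarrow> wick \<kappa> (d2 c) (d2 e)"
  by (auto simp: wick_def d1_def d2_def simp del: of_nat_Suc)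

lemma wick_cmult: "wick \<kappa> c e \<Longrightarrow> wick \<kappa> (\<lambda>p. k * c p) (\<lambda>p. k * e p)"
  by (auto simp: wick_def)

lemma wick_converges:
  assumes "wick \<kappa> c e" "converges c r" shows "converges e r"
proof (rule converges_mono[OF assms(2)])
  fix p :: "nat \<times> nat"
  obtain m n where p: "p = (m, n)" by force
  have "norm (complex_of_real (e (m, n))) = norm (\<kappa> * \<i> ^ m * complex_of_real (c (m, n)))"
    using assms(1) by (simp add: wick_def)
  then show "\<bar>e p\<bar> \<le> norm \<kappa> * \<bar>c p\<bar>" by (simp add: p norm_mult norm_power)
qed

lemma wick_psum:
  assumes w: "wick \<kappa> c e" and c: "converges c r" and xy: "\<bar>x\<bar> < r" "\<bar>y\<bar> < r"
  shows "complex_of_real (psum e x y) = \<kappa> * psum c (\<i> * of_real x) (of_real y)"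
proof -
  have "complex_of_real (psum e x y) = psum e (of_real x) (of_real y)"
    using psum_of_real[OF wick_converges[OF w c] xy, where 'a = complex] by simp
  also have "\<dots> = (\<Sum>\<^sub>\<infinity>p\<in>UNIV. \<kappa> * (case p of (m, n) \<Rightarrow> of_real (c (m, n)) * (\<i> * of_real x) ^ m * of_real y ^ n))"
    unfolding psum_def using w
    by (intro infsum_cong) (auto simp: wick_def power_mult_distrib mult_ac)
  also have "\<dots> = \<kappa> * psum c (\<i> * of_real x) (of_real y)"
    unfolding psum_def by (rule infsum_cmult_right')
  finally show ?thesis .
qed

section \<open>Rewriting the rotated surface as a graph over the other plane\<close>

text \<open>
  The map \<open>(t,x) \<mapsto> (H(t,x), x)\<close> has the identity as derivative at the origin, so it has a local
  inverse \<open>(y,x) \<mapsto> (f(x,y), x)\<close>. Implicit differentiation gives \<open>f\<^sub>x = - H\<^sub>x / H\<^sub>t\<close> at \<open>(f,x)\<close>. On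
  the axis \<open>H\<^sub>t = 1\<close> and \<open>H\<^sub>x = 0\<close>, so also \<open>f\<^sub>x = 0\<close> there, and the next \<open>x\<close>-derivative reduces to
  \<open>- H\<^sub>x\<^sub>x\<close>.
\<close>
lemma implicit_t_graph:
  assumes e: "converges e r" and r: "r > 0"
    and axis: "\<And>t. \<bar>t\<bar> < r \<Longrightarrow> psum e t 0 = t" and flat: "\<And>t. \<bar>t\<bar> < r \<Longrightarrow> psum (d2 e) t 0 = 0"
  obtains f s where "s > 0" "rewritten_as_t_graph (psum e) f"
    "\<And>y. \<bar>y\<bar> < s \<Longrightarrow> ((\<lambda>x. pd1 f x y) has_field_derivative - psum (d2 (d2 e)) y 0) (at 0)"
proof -
  \<comment> \<open>\<open>H\<^sub>t \<noteq> 0\<close> is built into the domain so that implicit differentiation is possible on all of it.\<close>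
  define U where "U = ({-r<..<r} \<times> {-r<..<r}) \<inter> (\<lambda>p. psum (d1 e) (fst p) (snd p)) -` (- {0})"
  note e1 = converges_d1[OF e] and e2 = converges_d2[OF e]
  have cont: "continuous_on ({-r<..<r} \<times> {-r<..<r}) (\<lambda>p. psum c (fst p) (snd p))" if "converges c r" for c
    using psum_isCont[OF that] by (auto simp: continuous_on_eq_continuous_at open_Times)
  have openU: "open U"
    unfolding U_def by (rule continuous_open_preimage[OF cont[OF e1]]) (auto simp: open_Times)
  have steep: "psum (d1 e) t 0 = 1" if t: "\<bar>t\<bar> < r" for t
  proof -
    have "((\<lambda>t. psum e t 0) has_field_derivative psum (d1 e) t 0) (at t)"
      using psum_deriv1[OF e, of t 0] t r by simp
    moreover have "((\<lambda>t. psum e t 0) has_field_derivative 1) (at t)"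
      by (rule has_field_derivative_transform_within_open[OF DERIV_ident, of "{-r<..<r}"])
        (use t axis in auto)
    ultimately show ?thesis by (rule DERIV_unique)
  qed
  define \<Phi> where "\<Phi> = (\<lambda>p :: real \<times> real. (psum e (fst p) (snd p), snd p))"
  define A B C where "A = Blinfun (\<lambda>h :: real \<times> real. (fst h, 0 :: real))"
    and "B = Blinfun (\<lambda>h :: real \<times> real. (snd h, 0 :: real))"
    and "C = Blinfun (\<lambda>h :: real \<times> real. (0 :: real, snd h))"
  have app: "blinfun_apply A h = (fst h, 0)" "blinfun_apply B h = (snd h, 0)" "blinfun_apply C h = (0, snd h)" for h
    unfolding A_def B_def C_def
    by (subst bounded_linear_Blinfun_apply; (intro bounded_linear_intros | simp))+
  define \<Phi>' where "\<Phi>' = (\<lambda>p :: real \<times> real. psum (d1 e) (fst p) (snd p) *\<^sub>R A + psum (d2 e) (fst p) (snd p) *\<^sub>R B + C)"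
  obtain U' V g g' where U': "open U'" "U' \<subseteq> U" "(0, 0) \<in> U'" and V: "open V" "\<Phi> (0, 0) \<in> V"
    and hom: "homeomorphism U' V \<Phi> g"
    and g: "\<And>q. q \<in> V \<Longrightarrow> (g has_derivative g' q) (at q)"
  proof (rule inverse_function_theorem[OF openU])
    show "(\<Phi> has_derivative blinfun_apply (\<Phi>' p)) (at p)" if "p \<in> U" for p
    proof -
      obtain t x where p: "p = (t, x)" by force
      have "\<bar>t\<bar> < r" "\<bar>x\<bar> < r" using that by (auto simp: U_def p)
      then have "(\<Phi> has_derivative (\<lambda>h. (psum (d1 e) t x * fst h + psum (d2 e) t x * snd h, snd h))) (at p)"
        unfolding \<Phi>_def p
        by (intro has_derivative_Pair psum_has_derivative[OF e] has_derivative_snd has_derivative_ident)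
      moreover have "blinfun_apply (\<Phi>' p) = (\<lambda>h. (psum (d1 e) t x * fst h + psum (d2 e) t x * snd h, snd h))"
        by (auto simp: \<Phi>'_def p app blinfun.add_left blinfun.scaleR_left)
      ultimately show ?thesis by simp
    qed
    show "continuous_on U \<Phi>'"
      unfolding \<Phi>'_def
      by (intro continuous_intros continuous_on_subset[OF cont[OF e1]] continuous_on_subset[OF cont[OF e2]])
        (auto simp: U_def)
    show "(0, 0) \<in> U" using r steep[of 0] by (auto simp: U_def)
    show "id_blinfun o\<^sub>L \<Phi>' (0, 0) = id_blinfun"
      using r steep[of 0] flat[of 0] by (intro blinfun_eqI) (auto simp: \<Phi>'_def app blinfun.add_left)
  qed blast
  define f where "f = (\<lambda>x y. fst (g (y, x)))"
  have \<Phi>g: "\<Phi> (g q) = q" "g q \<in> U'" if "q \<in> V" for q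
    using hom that by (auto simp: homeomorphism_def)
  have g\<Phi>: "g (\<Phi> p) = p" if "p \<in> U'" for p
    using hom that by (auto simp: homeomorphism_def)
  have gf: "g (y, x) = (f x y, x)" and ef: "psum e (f x y) x = y" and fU: "(f x y, x) \<in> U" if "(y, x) \<in> V" for x y
  proof -
    show *: "g (y, x) = (f x y, x)" using \<Phi>g(1)[OF that] by (auto simp: \<Phi>_def f_def prod_eq_iff)
    show "psum e (f x y) x = y" using \<Phi>g(1)[OF that] by (auto simp: \<Phi>_def *)
    show "(f x y, x) \<in> U" using \<Phi>g(2)[OF that] U'(2) * by auto
  qed
  have \<Phi>0: "\<Phi> (0, 0) = (0, 0)" using axis[of 0] r by (simp add: \<Phi>_def)
  have "rewritten_as_t_graph (psum e) f"
  proof -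
    have "open {(t, x, y). (t, x) \<in> U' \<and> (y, x) \<in> V}"
    proof -
      have "{(t, x, y). (t, x) \<in> U' \<and> (y, x) \<in> V} =
          (\<lambda>p. (fst p, fst (snd p))) -` U' \<inter> (\<lambda>p. (snd (snd p), fst (snd p))) -` V" by auto
      also have "open \<dots>"
        by (intro open_Int open_vimage U' V continuous_intros)
      finally show ?thesis .
    qed
    moreover have "(0, 0, 0) \<in> {(t, x, y). (t, x) \<in> U' \<and> (y, x) \<in> V}" using U' V \<Phi>0 by auto
    ultimately have "\<forall>\<^sub>F p in nhds (0, 0, 0). p \<in> {(t, x, y). (t, x) \<in> U' \<and> (y, x) \<in> V}"
      by (rule eventually_nhds_in_open)
    then show ?thesis
      unfolding rewritten_as_t_graph_def
    proof eventually_elim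
      case (elim p)
      obtain t x y where p: "p = (t, x, y)" by (metis prod.exhaust)
      have t: "(t, x) \<in> U'" and y: "(y, x) \<in> V" using elim by (auto simp: p)
      have "y = psum e t x \<longleftrightarrow> t = f x y"
      proof
        assume "y = psum e t x"
        then show "t = f x y" using g\<Phi>[OF t] by (simp add: \<Phi>_def f_def)
      qed (use ef[OF y] in simp)
      then show ?case by (simp add: p)
    qed
  qed
  moreover obtain s where s: "s > 0" "s \<le> r" "\<And>y. \<bar>y\<bar> < s \<Longrightarrow> (y, 0) \<in> U' \<inter> V"
  proof -
    have "open ((\<lambda>y. (y, 0)) -` (U' \<inter> V))"
      by (intro open_vimage open_Int U' V continuous_intros)
    moreover have "0 \<in> (\<lambda>y. (y, 0)) -` (U' \<inter> V)" using U' V \<Phi>0 by auto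
    ultimately obtain s where "s > 0" "ball 0 s \<subseteq> (\<lambda>y. (y, 0)) -` (U' \<inter> V)"
      using open_contains_ball by blast
    then show ?thesis using r by (intro that[of "min s r"]) auto
  qed
  moreover have "((\<lambda>x. pd1 f x y) has_field_derivative - psum (d2 (d2 e)) y 0) (at 0)" if y: "\<bar>y\<bar> < s" for y
  proof -
    define W where "W = (\<lambda>x. (y, x)) -` V"
    have W: "open W" "0 \<in> W"
      using s(3)[OF y] unfolding W_def by (auto intro!: open_vimage V continuous_intros)
    have f0: "f 0 y = y"
      using g\<Phi>[of "(y, 0)"] s(2,3) y axis[of y] by (auto simp: \<Phi>_def f_def)
    have df: "((\<lambda>x. f x y) has_field_derivative
        - psum (d2 e) (f x y) x / psum (d1 e) (f x y) x) (at x)" if x: "x \<in> W" for x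
    proof -
      have xV: "(y, x) \<in> V" using x by (simp add: W_def)
      have fx: "\<bar>f x y\<bar> < r" "\<bar>x\<bar> < r" "psum (d1 e) (f x y) x \<noteq> 0"
        using fU[OF xV] by (auto simp: U_def)
      have "((\<lambda>x. (y, x)) has_derivative (\<lambda>h. (0, h))) (at x)"
        by (intro has_derivative_Pair has_derivative_const has_derivative_ident)
      from has_derivative_fst[OF has_derivative_compose[OF this g[OF xV]]]
      have "(\<lambda>x. f x y) differentiable (at x)"
        unfolding f_def differentiable_def by blast
      then obtain p where p: "((\<lambda>x. f x y) has_field_derivative p) (at x)"
        by (auto simp: real_differentiable_def)
      have "((\<lambda>x. psum e (f x y) x) has_field_derivative
          psum (d1 e) (f x y) x * p + psum (d2 e) (f x y) x * 1) (at x)"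
        by (rule psum_chain[OF e fx(1,2) p DERIV_ident])
      moreover have "((\<lambda>x. psum e (f x y) x) has_field_derivative 0) (at x)"
        by (rule has_field_derivative_transform_within_open[OF DERIV_const W(1) x])
          (simp add: ef W_def)
      ultimately have "psum (d1 e) (f x y) x * p + psum (d2 e) (f x y) x = 0"
        using DERIV_unique by fastforce
      then have "p = - psum (d2 e) (f x y) x / psum (d1 e) (f x y) x"
        using fx(3) by (simp add: field_simps)
      with p show ?thesis by simp
    qed
    have yr: "\<bar>f 0 y\<bar> < r" "\<bar>0::real\<bar> < r" using y s f0 r by auto
    have df0: "((\<lambda>x. f x y) has_field_derivative 0) (at 0)"
      using df[OF W(2)] flat[of y] yr f0 by simp
    have "((\<lambda>x. - psum (d2 e) (f x y) x / psum (d1 e) (f x y) x) has_field_derivative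
        - psum (d2 (d2 e)) y 0) (at 0)"
      by (rule DERIV_cong[OF DERIV_divide[OF DERIV_minus[OF psum_chain[OF e2 yr df0 DERIV_ident]]
              psum_chain[OF e1 yr df0 DERIV_ident]]])
        (use steep[of y] flat[of y] yr f0 in auto)
    then show ?thesis
    proof (rule has_field_derivative_transform_within_open[OF _ W])
      show "- psum (d2 e) (f x y) x / psum (d1 e) (f x y) x = pd1 f x y" if "x \<in> W" for x
        using DERIV_imp_deriv[OF df[OF that]] by (simp add: pd1_def)
    qed
  qed
  ultimately show ?thesis using that by blast
qed

section \<open>The Riccati equation and the types\<close>

text \<open>
  The difference \<open>u = a - b\<close> satisfies the linear equation \<open>u' = - (a + b) u\<close>, so \<open>u\<close> times the
  exponential of an antiderivative of \<open>a + b\<close> is constant, and it vanishes at \<open>0\<close>.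
\<close>
lemma riccati_unique:
  fixes a b :: "real \<Rightarrow> real"
  assumes a: "\<And>x. \<bar>x\<bar> < s \<Longrightarrow> (a has_field_derivative - ((a x)\<^sup>2 + \<mu>)) (at x)"
    and b: "\<And>x. \<bar>x\<bar> < s \<Longrightarrow> (b has_field_derivative - ((b x)\<^sup>2 + \<mu>)) (at x)"
    and eq: "a 0 = b 0" and x: "\<bar>x\<bar> < s"
  shows "a x = b x"
proof -
  define t where "t = \<bar>x\<bar>"
  have t: "t \<ge> 0" "t < s" "\<And>z. z \<in> {-t..t} \<Longrightarrow> \<bar>z\<bar> < s" using x by (auto simp: t_def)
  have "isCont (\<lambda>z. a z + b z) z" if "z \<in> {-t..t}" for z
    using DERIV_isCont[OF a] DERIV_isCont[OF b] t(3)[OF that] by (auto intro: continuous_intros)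
  then have "continuous_on {-t..t} (\<lambda>z. a z + b z)"
    by (simp add: continuous_at_imp_continuous_on)
  then obtain Q where Q: "\<And>z. z \<in> {-t..t} \<Longrightarrow> (Q has_vector_derivative a z + b z) (at z within {-t..t})"
    using antiderivative_continuous by blast
  have "((\<lambda>z. (a z - b z) * exp (Q z)) has_field_derivative 0) (at z within {-t..t})"
    if z: "z \<in> {-t..t}" for z
  proof -
    have "(Q has_field_derivative a z + b z) (at z within {-t..t})"
      using Q[OF z] by (simp add: has_real_derivative_iff_has_vector_derivative)
    note [derivative_intros] = this
      a[OF t(3)[OF z], THEN has_field_derivative_at_within]
      b[OF t(3)[OF z], THEN has_field_derivative_at_within]
    show ?thesis
      by (auto intro!: derivative_eq_intros simp: algebra_simps power2_eq_square)
  qed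
  from has_field_derivative_zero_constant[OF convex_real_interval(5) this]
  obtain k where k: "\<And>z. z \<in> {-t..t} \<Longrightarrow> (a z - b z) * exp (Q z) = k" by blast
  have "k = 0" using k[of 0] t(1) eq by simp
  moreover have "x \<in> {-t..t}" by (auto simp: t_def)
  ultimately show ?thesis using k[of x] by simp
qed

lemma riccati_solution:
  fixes a :: "real \<Rightarrow> real"
  assumes s: "s > 0" and a: "\<And>x. \<bar>x\<bar> < s \<Longrightarrow> (a has_field_derivative - ((a x)\<^sup>2 + \<mu>)) (at x)"
    and a0: "a 0 = 0"
  shows "\<mu> > 0 \<Longrightarrow> \<forall>\<^sub>F x in nhds 0. a x = - (sqrt \<mu> * tan (sqrt \<mu> * x))"
    and "\<mu> = 0 \<Longrightarrow> \<forall>\<^sub>F x in nhds 0. a x = 0"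
    and "\<mu> < 0 \<Longrightarrow> \<forall>\<^sub>F x in nhds 0. a x = sqrt (- \<mu>) * tanh (sqrt (- \<mu>) * x)"
proof -
  have near: "\<forall>\<^sub>F x in nhds 0. a x = b x"
    if b: "\<And>x. \<bar>x\<bar> < s' \<Longrightarrow> (b has_field_derivative - ((b x)\<^sup>2 + \<mu>)) (at x)" and "s' > 0" "b 0 = 0" for b s'
  proof -
    have "\<forall>\<^sub>F x in nhds 0. x \<in> {-min s s'<..<min s s'}"
      using s \<open>s' > 0\<close> by (intro eventually_nhds_in_open) auto
    then show ?thesis
    proof eventually_elim
      case (elim x)
      show ?case
        by (rule riccati_unique[of "min s s'"]) (use elim a b a0 \<open>b 0 = 0\<close> in auto)
    qed
  qed
  show "\<forall>\<^sub>F x in nhds 0. a x = - (sqrt \<mu> * tan (sqrt \<mu> * x))" if \<mu>: "\<mu> > 0"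
  proof (rule near)
    show "pi / (2 * sqrt \<mu>) > 0" using \<mu> by simp
    fix x assume x: "\<bar>x\<bar> < pi / (2 * sqrt \<mu>)"
    then have "\<bar>sqrt \<mu> * x\<bar> < pi / 2" using \<mu> by (simp add: abs_mult field_simps)
    then have "cos (sqrt \<mu> * x) > 0" by (intro cos_gt_zero_pi) (auto simp: abs_less_iff)
    then have "((\<lambda>x. - (sqrt \<mu> * tan (sqrt \<mu> * x))) has_field_derivative
        - (sqrt \<mu> * (inverse ((cos (sqrt \<mu> * x))\<^sup>2) * sqrt \<mu>))) (at x)"
      by (auto intro!: derivative_eq_intros)
    also have "inverse ((cos (sqrt \<mu> * x))\<^sup>2) = 1 + (tan (sqrt \<mu> * x))\<^sup>2"
      using tan_sec[of "sqrt \<mu> * x"] \<open>cos (sqrt \<mu> * x) > 0\<close> by (simp add: power_inverse)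
    also have "- (sqrt \<mu> * ((1 + (tan (sqrt \<mu> * x))\<^sup>2) * sqrt \<mu>)) =
        - ((- (sqrt \<mu> * tan (sqrt \<mu> * x)))\<^sup>2 + sqrt \<mu> * sqrt \<mu>)"
      by (simp add: algebra_simps power2_eq_square del: real_sqrt_mult_self)
    also have "sqrt \<mu> * sqrt \<mu> = \<mu>" using \<mu> by simp
    finally show "((\<lambda>x. - (sqrt \<mu> * tan (sqrt \<mu> * x))) has_field_derivative
        - ((- (sqrt \<mu> * tan (sqrt \<mu> * x)))\<^sup>2 + \<mu>)) (at x)" .
  qed simp
  show "\<forall>\<^sub>F x in nhds 0. a x = 0" if "\<mu> = 0"
    by (rule near[of 1]) (use that in auto)
  show "\<forall>\<^sub>F x in nhds 0. a x = sqrt (- \<mu>) * tanh (sqrt (- \<mu>) * x)" if \<mu>: "\<mu> < 0"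
  proof (rule near)
    define k where "k = sqrt (- \<mu>)"
    have k: "k\<^sup>2 = - \<mu>" using \<mu> by (simp add: k_def)
    fix x :: real
    have "((\<lambda>x. k * tanh (k * x)) has_field_derivative k * ((1 - (tanh (k * x))\<^sup>2) * k)) (at x)"
      by (auto intro!: derivative_eq_intros)
    also have "k * ((1 - (tanh (k * x))\<^sup>2) * k) = - ((k * tanh (k * x))\<^sup>2 - k\<^sup>2)"
      by (simp add: algebra_simps power2_eq_square)
    finally show "((\<lambda>x. sqrt (- \<mu>) * tanh (sqrt (- \<mu>) * x)) has_field_derivative
        - ((sqrt (- \<mu>) * tanh (sqrt (- \<mu>) * x))\<^sup>2 + \<mu>)) (at x)"
      unfolding k k_def[symmetric] by simp
  qed (rule zero_less_one, simp)
qed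

text \<open>
  Differentiability of \<open>\<phi>\<close> is not assumed: both sides choose a derivative from the same, possibly
  empty, set of candidates.
\<close>
lemma deriv_rescale:
  fixes \<phi> :: "real \<Rightarrow> real"
  assumes k: "k \<noteq> 0"
  shows "deriv (\<lambda>s. k * \<phi> (s / k)) x = deriv \<phi> (x / k)"
proof -
  have "((\<lambda>s. k * \<phi> (s / k)) has_field_derivative D) (at x) \<longleftrightarrow> (\<phi> has_field_derivative D) (at (x / k))" for D
  proof
    assume D: "((\<lambda>s. k * \<phi> (s / k)) has_field_derivative D) (at x)"
    have "((\<lambda>s. k * s) has_field_derivative k) (at (x / k))"
      by (auto intro!: derivative_eq_intros)
    moreover have "((\<lambda>s. k * \<phi> (s / k)) has_field_derivative D) (at (k * (x / k)))"
      using D k by simp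
    ultimately have "((\<lambda>s. inverse k * (k * \<phi> (k * s / k))) has_field_derivative inverse k * (D * k)) (at (x / k))"
      by (intro DERIV_cmult) (rule DERIV_chain2)
    then show "(\<phi> has_field_derivative D) (at (x / k))" using k by (simp add: field_simps)
  next
    assume D: "(\<phi> has_field_derivative D) (at (x / k))"
    have "((\<lambda>s. s / k) has_field_derivative 1 / k) (at x)"
      using k by (auto intro!: derivative_eq_intros)
    from DERIV_cmult[OF DERIV_chain2[OF D this], of k]
    show "((\<lambda>s. k * \<phi> (s / k)) has_field_derivative D) (at x)" using k by simp
  qed
  then show ?thesis by (simp add: deriv_def)
qed

lemma approx_fun_homothety:
  assumes k: "k \<noteq> 0" and F: "((\<lambda>x. pd1 F x (y / k)) has_field_derivative a) (at 0)"
  shows "approx_fun (homothety k F) y = a / k"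
proof -
  have "pd1 (homothety k F) x y = pd1 F (x / k) (y / k)" for x
    unfolding pd1_def homothety_def using deriv_rescale[OF k, of "\<lambda>s. F s (y / k)"] by simp
  moreover have "((\<lambda>x. pd1 F (x / k) (y / k)) has_field_derivative a * (1 / k)) (at 0)"
    by (rule DERIV_chain2[where f = "\<lambda>x. pd1 F x (y / k)" and g = "\<lambda>x. x / k"])
      (use F k in \<open>auto intro!: derivative_eq_intros\<close>)
  ultimately show ?thesis
    by (simp add: approx_fun_def pd1_def[of "pd1 _"] DERIV_imp_deriv)
qed

text \<open>
  A homothety with factor \<open>k\<close> turns \<open>\<alpha>\<close> into \<open>\<alpha>(y/k)/k\<close> and \<open>\<mu>\<close> into \<open>\<mu>/k\<^sup>2\<close>, so it preserves the
  sign of \<open>\<mu>\<close>. When \<open>\<alpha>(0) = 0\<close>, that sign therefore decides the type in both directions.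
\<close>
context
  fixes F :: "real \<Rightarrow> real \<Rightarrow> real" and \<alpha> :: "real \<Rightarrow> real" and s \<mu> :: real
  assumes s: "s > 0"
    and F: "\<And>y. \<bar>y\<bar> < s \<Longrightarrow> ((\<lambda>x. pd1 F x y) has_field_derivative \<alpha> y) (at 0)"
    and \<alpha>: "\<And>y. \<bar>y\<bar> < s \<Longrightarrow> (\<alpha> has_field_derivative - ((\<alpha> y)\<^sup>2 + \<mu>)) (at y)"
    and \<alpha>0: "\<alpha> 0 = 0"
begin

lemma approx_fun_homothety_near_0:
  assumes k: "k > 0" shows "\<forall>\<^sub>F y in nhds 0. approx_fun (homothety k F) y = \<alpha> (y / k) / k"
proof -
  have "\<forall>\<^sub>F y in nhds 0. y \<in> {-(s * k)<..<s * k}"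
    using s k by (intro eventually_nhds_in_open) auto
  then show ?thesis
  proof eventually_elim
    case (elim y)
    then have "\<bar>y / k\<bar> < s" using k by (auto simp: abs_less_iff field_simps)
    from approx_fun_homothety[OF _ F[OF this]] show ?case using k by simp
  qed
qed

text \<open>
  Comparing derivatives at \<open>0\<close> suffices to recover the constant: there the Riccati equations of
  \<open>\<alpha>\<close> and of the normal form \<open>\<beta>\<close> read \<open>\<alpha>' = - \<mu>\<close> and \<open>\<beta>' = - \<nu>\<close>.
\<close>
lemma of_type_imp_mu:
  assumes "of_type F A"
    and A: "\<And>\<beta>. \<beta> \<in> A \<Longrightarrow> (\<beta> has_field_derivative - ((\<beta> 0)\<^sup>2 + \<nu>)) (at 0)"
  shows "\<exists>k>0. \<mu> = k\<^sup>2 * \<nu>"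
proof -
  from assms(1) obtain k \<beta> where k: "k > 0" and \<beta>: "\<beta> \<in> A"
    and eq: "\<forall>\<^sub>F y in nhds 0. approx_fun (homothety k F) y = \<beta> y"
    by (auto simp: of_type_def)
  from eq approx_fun_homothety_near_0[OF k]
  have ev: "\<forall>\<^sub>F y in nhds 0. \<alpha> (y / k) / k = \<beta> y" by eventually_elim simp
  then have \<beta>0: "\<beta> 0 = 0" using eventually_nhds_x_imp_x[OF ev] \<alpha>0 by simp
  have "(\<alpha> has_field_derivative - \<mu>) (at (0 / k))" using \<alpha>[of 0] s \<alpha>0 by simp
  moreover have "((\<lambda>y. y / k) has_field_derivative 1 / k) (at 0)"
    using k by (auto intro!: derivative_eq_intros)
  ultimately have "((\<lambda>y. \<alpha> (y / k) / k) has_field_derivative - \<mu> * (1 / k) / k) (at 0)"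
    by (intro DERIV_cdivide) (rule DERIV_chain2)
  then have "(\<beta> has_field_derivative - \<mu> * (1 / k) / k) (at 0)"
    using DERIV_cong_ev[OF refl ev refl] by blast
  moreover have "(\<beta> has_field_derivative - \<nu>) (at 0)" using A[OF \<beta>] \<beta>0 by simp
  ultimately have "- \<mu> * (1 / k) / k = - \<nu>" by (rule DERIV_unique)
  then show ?thesis using k by (intro exI[of _ k]) (auto simp: field_simps power2_eq_square)
qed

lemma of_typeI:
  assumes k: "k > 0" and ev: "\<forall>\<^sub>F x in nhds 0. \<alpha> x = k * \<beta> (k * x)" and "\<beta> \<in> A"
  shows "of_type F A"
proof -
  have "filterlim (\<lambda>y. y / k) (nhds (0 / k)) (nhds 0)" 
    by (rule tendsto_divide[OF filterlim_ident tendsto_const]) (use k in auto)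
  then have "\<forall>\<^sub>F y in nhds 0. \<alpha> (y / k) = k * \<beta> (k * (y / k))"
    using eventually_compose_filterlim[OF ev, of "\<lambda>y. y / k" "nhds 0"] by simp
  with approx_fun_homothety_near_0[OF k]
  have "\<forall>\<^sub>F y in nhds 0. approx_fun (homothety k F) y = \<beta> y"
    by eventually_elim (use k in simp)
  then show ?thesis using assms by (auto simp: of_type_def)
qed

lemma of_type_alpha_plus_iff: "of_type F alpha_plus \<longleftrightarrow> \<mu> > 0"
proof
  assume "of_type F alpha_plus"
  then have "\<exists>k>0. \<mu> = k\<^sup>2 * 1"
  proof (rule of_type_imp_mu)
    fix \<beta> :: "real \<Rightarrow> real" assume "\<beta> \<in> alpha_plus"
    then obtain c where c: "\<beta> = (\<lambda>y. - tan (y + c))" "\<bar>c\<bar> < pi / 2" by (auto simp: alpha_plus_def)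
    have cos: "cos c > 0" by (rule cos_gt_zero_pi) (use c(2) in \<open>auto simp: abs_less_iff\<close>)
    then show "(\<beta> has_field_derivative - ((\<beta> 0)\<^sup>2 + 1)) (at 0)"
      unfolding c using tan_sec[of c] cos by (auto intro!: derivative_eq_intros simp: power_inverse)
  qed
  then show "\<mu> > 0" by auto
next
  assume "\<mu> > 0"
  then show "of_type F alpha_plus"
    using riccati_solution(1)[OF s \<alpha> \<alpha>0]
    by (intro of_typeI[of "sqrt \<mu>" "\<lambda>y. - tan (y + 0)"]) (auto simp: alpha_plus_def intro!: exI[of _ "0 :: real"])
qed

lemma of_type_alpha_zero_I_iff: "of_type F alpha_zero_I \<longleftrightarrow> \<mu> = 0"
proof
  assume "of_type F alpha_zero_I"
  then have "\<exists>k>0. \<mu> = k\<^sup>2 * 0"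
    by (rule of_type_imp_mu) (auto simp: alpha_zero_I_def)
  then show "\<mu> = 0" by auto
next
  assume "\<mu> = 0"
  then show "of_type F alpha_zero_I"
    using riccati_solution(2)[OF s \<alpha> \<alpha>0]
    by (intro of_typeI[of 1 "\<lambda>y. 0"]) (auto simp: alpha_zero_I_def)
qed

lemma of_type_alpha_minus_I_iff: "of_type F alpha_minus_I \<longleftrightarrow> \<mu> < 0"
proof
  assume "of_type F alpha_minus_I"
  then have "\<exists>k>0. \<mu> = k\<^sup>2 * (- 1)"
  proof (rule of_type_imp_mu)
    fix \<beta> :: "real \<Rightarrow> real" assume "\<beta> \<in> alpha_minus_I"
    then obtain c where c: "\<beta> = (\<lambda>y. tanh (y + c))" by (auto simp: alpha_minus_I_def)
    show "(\<beta> has_field_derivative - ((\<beta> 0)\<^sup>2 + - 1)) (at 0)"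
      unfolding c by (auto intro!: derivative_eq_intros)
  qed
  then show "\<mu> < 0" by auto
next
  assume "\<mu> < 0"
  then show "of_type F alpha_minus_I"
    using riccati_solution(3)[OF s \<alpha> \<alpha>0]
    by (intro of_typeI[of "sqrt (- \<mu>)" "\<lambda>y. tanh (y + 0)"]) (auto simp: alpha_minus_I_def intro!: exI[of _ "0 :: real"])
qed

end

text \<open>
  Along the axis \<open>G\<^sub>x = 1\<close>, and \<open>G\<^sub>y\<close>, \<open>G\<^sub>x\<^sub>x\<close>, \<open>G\<^sub>x\<^sub>y\<close> and \<open>G\<^sub>x\<^sub>x\<^sub>y\<close> vanish. So in the second
  \<open>y\<close>-derivative of the equation only \<open>G\<^sub>x\<^sub>x\<^sub>y\<^sub>y = \<alpha>''\<close> and the product of \<open>G\<^sub>y\<^sub>y = \<alpha>\<close> with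
  \<open>G\<^sub>x\<^sub>y\<^sub>y = \<alpha>'\<close> survive.
\<close>
lemma second_normal_derivative_of_zmc:
  assumes c: "converges c r" and zmc: "\<And>x y :: real. \<bar>x\<bar> < r \<Longrightarrow> \<bar>y\<bar> < r \<Longrightarrow> zmc_op c x y = 0"
    and axis: "\<And>x. \<bar>x\<bar> < r \<Longrightarrow> psum c x 0 = x" and flat: "\<And>x. \<bar>x\<bar> < r \<Longrightarrow> psum (d2 c) x 0 = 0"
    and x: "\<bar>x\<bar> < r"
  shows "psum (d1 (d1 (d2 (d2 c)))) x 0 + 2 * psum (d2 (d2 c)) x 0 * psum (d1 (d2 (d2 c))) x 0 = 0"
proof -
  have r: "r > 0" using x by linarith
  note conv = c converges_d1 converges_d2
  have along: "psum (d1 e) t 0 = D"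
    if e: "converges e r" and eq: "\<And>t. \<bar>t\<bar> < r \<Longrightarrow> psum e t 0 = h t"
      and h: "(h has_field_derivative D) (at t)" and t: "\<bar>t\<bar> < r" for e h D and t :: real
  proof -
    have "((\<lambda>t. psum e t 0) has_field_derivative psum (d1 e) t 0) (at t)"
      using psum_deriv1[OF e, of t 0] t r by simp
    moreover have "((\<lambda>t. psum e t 0) has_field_derivative D) (at t)"
      by (rule has_field_derivative_transform_within_open[OF h, of "{-r<..<r}"]) (use t eq in auto)
    ultimately show ?thesis by (rule DERIV_unique)
  qed
  have p0: "psum (d1 c) t 0 = 1" if "\<bar>t\<bar> < r" for t
    by (rule along[OF c axis _ that]) auto
  have r0: "psum (d1 (d1 c)) t 0 = 0" if "\<bar>t\<bar> < r" for t
    by (rule along[OF _ p0 _ that]) (auto intro: conv)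
  have s0: "psum (d1 (d2 c)) t 0 = 0" if "\<bar>t\<bar> < r" for t
    by (rule along[OF _ flat _ that]) (auto intro: conv)
  have ry0: "psum (d1 (d1 (d2 c))) t 0 = 0" if "\<bar>t\<bar> < r" for t
    by (rule along[OF _ s0 _ that]) (auto intro: conv)
  note zero = p0[OF x] r0[OF x] s0[OF x] ry0[OF x] flat[OF x]
  have dy: "((\<lambda>y. psum e x y) has_field_derivative psum (d2 e) x y) (at y)" if "converges e r" "\<bar>y\<bar> < r" for e y
    using psum_deriv2[OF that(1), of x y] x that by simp
  define p where "p = (\<lambda>y. psum (d1 c) x y)"
  define q where "q = (\<lambda>y. psum (d2 c) x y)"
  define u where "u = (\<lambda>y. psum (d1 (d1 c)) x y)"
  define v where "v = (\<lambda>y. psum (d1 (d2 c)) x y)"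
  define w where "w = (\<lambda>y. psum (d2 (d2 c)) x y)"
  define u' where "u' = (\<lambda>y. psum (d1 (d1 (d2 c))) x y)"
  define v' where "v' = (\<lambda>y. psum (d1 (d2 (d2 c))) x y)"
  define w' where "w' = (\<lambda>y. psum (d2 (d2 (d2 c))) x y)"
  define u'' where "u'' = (\<lambda>y. psum (d1 (d1 (d2 (d2 c)))) x y)"
  define v'' where "v'' = (\<lambda>y. psum (d1 (d2 (d2 (d2 c)))) x y)"
  define w'' where "w'' = (\<lambda>y. psum (d2 (d2 (d2 (d2 c)))) x y)"
  note defs = p_def q_def u_def v_def w_def u'_def v'_def w'_def u''_def v''_def w''_def
  have D: "(p has_field_derivative v y) (at y)" "(q has_field_derivative w y) (at y)"
    "(u has_field_derivative u' y) (at y)" "(v has_field_derivative v' y) (at y)"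
    "(w has_field_derivative w' y) (at y)" "(u' has_field_derivative u'' y) (at y)"
    "(v' has_field_derivative v'' y) (at y)" "(w' has_field_derivative w'' y) (at y)"
    if "\<bar>y\<bar> < r" for y
    unfolding defs using that
    by (rule dy[THEN DERIV_cong, rotated 1]; simp add: conv d2_d1_commute)+
  have E: "(1 - (q y)\<^sup>2) * u y + 2 * p y * q y * v y + (1 - (p y)\<^sup>2) * w y = 0" if "\<bar>y\<bar> < r" for y
    using zmc[OF x that] by (simp add: zmc_op_def defs d2_d1_commute)
  \<comment> \<open>The first derivative in simplified form: the two terms \<open>2pqv\<close> and \<open>(1 - p\<^sup>2)w\<close> each
      produce \<open>2pvw\<close>, with opposite signs.\<close>
  have E': "- 2 * q y * w y * u y + (1 - (q y)\<^sup>2) * u' y + 2 * q y * (v y)\<^sup>2 + 2 * p y * q y * v' y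
      + (1 - (p y)\<^sup>2) * w' y = 0" (is "?E y = 0") if y: "\<bar>y\<bar> < r" for y
  proof -
    have "((\<lambda>y. (1 - (q y)\<^sup>2) * u y + 2 * p y * q y * v y + (1 - (p y)\<^sup>2) * w y)
        has_field_derivative ?E y) (at y)"
      by (rule DERIV_cong, (rule derivative_intros D[OF y])+) (simp add: algebra_simps power2_eq_square)
    moreover have "((\<lambda>y. (1 - (q y)\<^sup>2) * u y + 2 * p y * q y * v y + (1 - (p y)\<^sup>2) * w y)
        has_field_derivative 0) (at y)"
      by (rule has_field_derivative_transform_within_open[OF DERIV_const, of "{-r<..<r}"]) (use y E in auto)
    ultimately show ?thesis by (rule DERIV_unique)
  qed
  have "((\<lambda>y. - 2 * q y * w y * u y + (1 - (q y)\<^sup>2) * u' y + 2 * q y * (v y)\<^sup>2 + 2 * p y * q y * v' y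
      + (1 - (p y)\<^sup>2) * w' y) has_field_derivative u'' 0 + 2 * w 0 * v' 0) (at 0)"
  proof -
    have "\<bar>0::real\<bar> < r" using r by simp
    note D0 = D[OF this]
    have z: "p 0 = 1" "q 0 = 0" "u 0 = 0" "v 0 = 0" "u' 0 = 0" by (auto simp: defs zero)
    show ?thesis by (rule DERIV_cong, (rule derivative_intros D0)+) (simp add: z)
  qed
  moreover have "((\<lambda>y. - 2 * q y * w y * u y + (1 - (q y)\<^sup>2) * u' y + 2 * q y * (v y)\<^sup>2 + 2 * p y * q y * v' y
      + (1 - (p y)\<^sup>2) * w' y) has_field_derivative 0) (at 0)"
    by (rule has_field_derivative_transform_within_open[OF DERIV_const, of "{-r<..<r}"]) (use r E' in auto)
  ultimately have "u'' 0 + 2 * w 0 * v' 0 = 0" by (rule DERIV_unique)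
  then show ?thesis by (simp add: defs)
qed

text \<open>
  The expression \<open>\<alpha>'' + 2 \<alpha> \<alpha>'\<close>, which vanishes by the preceding lemma, is the derivative of
  \<open>\<alpha>' + \<alpha>\<^sup>2\<close>.
\<close>
lemma riccati_along_axis:
  assumes c: "converges c r" and zmc: "\<And>x y :: real. \<bar>x\<bar> < r \<Longrightarrow> \<bar>y\<bar> < r \<Longrightarrow> zmc_op c x y = 0"
    and axis: "\<And>x. \<bar>x\<bar> < r \<Longrightarrow> psum c x 0 = x" and flat: "\<And>x. \<bar>x\<bar> < r \<Longrightarrow> psum (d2 c) x 0 = 0"
  shows "\<exists>\<mu>. \<forall>x. \<bar>x\<bar> < r \<longrightarrow> psum (d1 (d2 (d2 c))) x 0 = - ((psum (d2 (d2 c)) x 0)\<^sup>2 + \<mu>)"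
proof -
  have "((\<lambda>x. psum (d1 (d2 (d2 c))) x 0 + (psum (d2 (d2 c)) x 0)\<^sup>2) has_field_derivative 0)
      (at x within {-r<..<r})" if x: "x \<in> {-r<..<r}" for x
  proof -
    have x': "norm x < r" "norm (0::real) < r" using x by auto
    have "((\<lambda>x. psum (d1 (d2 (d2 c))) x 0 + (psum (d2 (d2 c)) x 0)\<^sup>2) has_field_derivative
       psum (d1 (d1 (d2 (d2 c)))) x 0 + 2 * psum (d2 (d2 c)) x 0 * psum (d1 (d2 (d2 c))) x 0) (at x)"
      using psum_deriv1[OF converges_d1[OF converges_d2[OF converges_d2[OF c]]] x']
        psum_deriv1[OF converges_d2[OF converges_d2[OF c]] x']
      by (auto intro!: derivative_eq_intros)
    also have "psum (d1 (d1 (d2 (d2 c)))) x 0 + 2 * psum (d2 (d2 c)) x 0 * psum (d1 (d2 (d2 c))) x 0 = 0"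
      by (rule second_normal_derivative_of_zmc[OF c zmc axis flat]) (use x in auto)
    finally show ?thesis by (rule has_field_derivative_at_within)
  qed
  from has_field_derivative_zero_constant[OF convex_real_interval(8) this]
  obtain k where k: "\<And>x. x \<in> {-r<..<r} \<Longrightarrow> psum (d1 (d2 (d2 c))) x 0 + (psum (d2 (d2 c)) x 0)\<^sup>2 = k"
    by blast
  have "psum (d1 (d2 (d2 c))) x 0 = - ((psum (d2 (d2 c)) x 0)\<^sup>2 + - k)" if "\<bar>x\<bar> < r" for x
    using k[of x] that by (simp add: abs_less_iff)
  then show ?thesis by blast
qed

section \<open>Parity and the rotated coefficients\<close>
lemma slice_of_real:
  assumes c: "converges c r" and y: "\<bar>y\<bar> < r"
  shows "slice c (complex_of_real y) n = of_real (slice c y n)"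
proof -
  have "((\<lambda>m. complex_of_real (c (n, m) * y ^ m)) has_sum of_real (slice c y n)) UNIV"
    using slice_has_sum[OF c, of y n] y by (intro has_sum_of_real) simp
  then show ?thesis unfolding slice_def[of c "complex_of_real y"] by (intro infsumI) simp
qed

lemma taylor_ext_psum:
  assumes c: "converges c r" and z: "norm z < r" and y: "\<bar>y\<bar> < r"
    and u: "\<And>s. \<bar>s\<bar> < r \<Longrightarrow> u s = psum c s y"
  shows "taylor_summable u z" and "taylor_ext u z = psum c z (of_real y)"
proof -
  have r: "r > 0" using y by linarith
  have "(deriv ^^ n) u 0 / fact n = slice c y n" for n
    by (rule powser_taylor[OF r]) (use slice_psum_sums[OF c _ _, of _ y] u y in auto)
  then have "(\<lambda>n. complex_of_real ((deriv ^^ n) u 0 / fact n) * z ^ n) sums psum c z (of_real y)"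
    using slice_psum_sums[OF c z, of "of_real y"] y by (simp add: slice_of_real[OF c y])
  then show "taylor_summable u z" "taylor_ext u z = psum c z (of_real y)"
    by (auto simp: taylor_summable_def taylor_ext_def sums_iff)
qed

lemma psum_uminus_left:
  "psum c (- x) y = psum (\<lambda>(m, n). (- 1) ^ m * c (m, n)) x y"
  unfolding psum_def by (intro infsum_cong) (auto simp: power_minus[of x])

lemma psum_parity:
  assumes c: "converges c r" and r: "r > 0"
    and parity: "\<And>x y :: real. \<bar>x\<bar> < r \<Longrightarrow> \<bar>y\<bar> < r \<Longrightarrow> psum c (- x) y = k * psum c x y"
  shows "(- 1) ^ m * c (m, n) = k * c (m, n)"
proof -
  have "(\<lambda>(m, n). (- 1) ^ m * c (m, n)) = (\<lambda>p. k * c p)"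
  proof (rule psum_unique[OF r])
    show "converges (\<lambda>(m, n). (- 1) ^ m * c (m, n)) r"
      by (rule converges_mono[OF c, of _ 1]) (auto simp: abs_mult)
    show "converges (\<lambda>p. k * c p) r" by (rule converges_cmult[OF c])
    show "psum (\<lambda>(m, n). (- 1) ^ m * c (m, n)) x y = psum (\<lambda>p. k * c p) x y"
      if "\<bar>x\<bar> < r" "\<bar>y\<bar> < r" for x y :: real
      using parity[OF that] by (simp add: psum_uminus_left psum_cmult)
  qed
  from fun_cong[OF this, of "(m, n)"] show ?thesis by simp
qed

lemma psum_odd:
  fixes x y :: real
  assumes "\<And>m n. even m \<Longrightarrow> c (m, n) = 0"
  shows "psum c (- x) y = - psum c x y"
proof -
  have "(\<lambda>(m, n). (- 1) ^ m * c (m, n)) = (\<lambda>p. - 1 * c p)"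
    using assms by (auto simp: fun_eq_iff uminus_power_if)
  then show ?thesis using psum_cmult[of "- 1" c x y] by (simp add: psum_uminus_left)
qed

text \<open>
  The sign equals \<open>\<i>\<^sup>m\<close> for even \<open>m\<close> and \<open>-\<i> \<i>\<^sup>m\<close> for odd \<open>m\<close>, so the same formula serves both
  rotations.
\<close>
definition wick_coeffs :: "(nat \<times> nat \<Rightarrow> real) \<Rightarrow> nat \<times> nat \<Rightarrow> real" where
  "wick_coeffs c = (\<lambda>(m, n). (- 1) ^ (m div 2) * c (m, n))"

lemma wick_wick_coeffs_even:
  assumes "\<And>m n. odd m \<Longrightarrow> c (m, n) = 0" shows "wick 1 c (wick_coeffs c)"
  unfolding wick_def
proof (intro allI)
  fix m n
  show "complex_of_real (wick_coeffs c (m, n)) = 1 * \<i> ^ m * complex_of_real (c (m, n))"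
  proof (cases "even m")
    case True
    then obtain k where "m = 2 * k" by blast
    then show ?thesis by (simp add: wick_coeffs_def power_mult)
  qed (simp add: assms wick_coeffs_def)
qed

lemma wick_wick_coeffs_odd:
  assumes "\<And>m n. even m \<Longrightarrow> c (m, n) = 0" shows "wick (- \<i>) c (wick_coeffs c)"
  unfolding wick_def
proof (intro allI)
  fix m n
  show "complex_of_real (wick_coeffs c (m, n)) = - \<i> * \<i> ^ m * complex_of_real (c (m, n))"
  proof (cases "odd m")
    case True
    then obtain k where "m = 2 * k + 1" by (rule oddE)
    then show ?thesis by (simp add: wick_coeffs_def power_mult power_add)
  qed (simp add: assms wick_coeffs_def)
qed

lemma d1_cmult: "d1 (\<lambda>p. k * c p) = (\<lambda>p. k * d1 c p)"
  and d2_cmult: "d2 (\<lambda>p. k * c p) = (\<lambda>p. k * d2 c p)"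
  by (auto simp: d1_def d2_def fun_eq_iff)

section \<open>The Born-Infeld equation and the lightlike segment\<close>
lemma born_infeld_psum:
  assumes e: "converges e r"
    and eq: "\<And>t x :: real. \<bar>t\<bar> < r \<Longrightarrow> \<bar>x\<bar> < r \<Longrightarrow>
      (1 - (psum (d1 e) t x)\<^sup>2) * psum (d2 (d2 e)) t x
      + 2 * psum (d1 e) t x * psum (d2 e) t x * psum (d2 (d1 e)) t x
      - (1 + (psum (d2 e) t x)\<^sup>2) * psum (d1 (d1 e)) t x = 0"
  shows "born_infeld_on (psum e) ({-r<..<r} \<times> {-r<..<r})"
  unfolding born_infeld_on_def
proof (intro ballI, clarify)
  fix t x assume "t \<in> {-r<..<r}" "x \<in> {-r<..<r}"
  then have tx: "\<bar>t\<bar> < r" "\<bar>x\<bar> < r" by auto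
  note p1 = pd1_eq_psum[OF e refl] and p2 = pd2_eq_psum[OF e refl]
  note p11 = pd1_eq_psum[OF converges_d1[OF e] p1]
    and p12 = pd2_eq_psum[OF converges_d1[OF e] p1]
    and p22 = pd2_eq_psum[OF converges_d2[OF e] p2]
  show "(1 - (pd1 (psum e) t x)\<^sup>2) * pd2 (pd2 (psum e)) t x
      + 2 * pd1 (psum e) t x * pd2 (psum e) t x * pd2 (pd1 (psum e)) t x
      - (1 + (pd2 (psum e) t x)\<^sup>2) * pd1 (pd1 (psum e)) t x = 0"
    using eq[OF tx] by (simp add: p1[OF tx] p2[OF tx] p11[OF _ _ tx] p12[OF _ _ tx] p22[OF _ _ tx])
qed

text \<open>
  With \<open>h(t,x) = g(\<i>x,t)\<close> each \<open>x\<close>-derivative of \<open>h\<close> contributes a factor \<open>\<i>\<close>. This reverses the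
  signs that distinguish the two equations, and the Born-Infeld operator of \<open>h\<close> becomes minus the
  zero mean curvature operator of \<open>g\<close>. The swap makes time the first argument.
\<close>
lemma born_infeld_wick_even:
  assumes w: "wick 1 c e" and c: "converges c r"
    and zmc: "\<And>x y :: real. \<bar>x\<bar> < r \<Longrightarrow> \<bar>y\<bar> < r \<Longrightarrow> zmc_op c x y = 0"
  shows "born_infeld_on (psum (e \<circ> prod.swap)) ({-r<..<r} \<times> {-r<..<r})"
proof (rule born_infeld_psum)
  have e: "converges e r" by (rule wick_converges[OF w c])
  then show "converges (e \<circ> prod.swap) r" by (rule converges_swap)
  fix t x :: real assume tx: "\<bar>t\<bar> < r" "\<bar>x\<bar> < r"
  note c1 = converges_d1[OF c] and c2 = converges_d2[OF c]
  have "complex_of_real ((1 - (psum (d2 e) x t)\<^sup>2) * psum (d1 (d1 e)) x t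
      + 2 * psum (d2 e) x t * psum (d1 e) x t * psum (d1 (d2 e)) x t
      - (1 + (psum (d1 e) x t)\<^sup>2) * psum (d2 (d2 e)) x t)
    = - zmc_op c (\<i> * of_real x) (of_real t)"
    unfolding zmc_op_def d2_d1_commute
    by (simp add: wick_psum[OF wick_d2[OF w] c2 tx(2,1)] wick_psum[OF wick_d1[OF w] c1 tx(2,1)]
        wick_psum[OF wick_d1[OF wick_d1[OF w]] converges_d1[OF c1] tx(2,1)]
        wick_psum[OF wick_d1[OF wick_d2[OF w]] converges_d1[OF c2] tx(2,1)]
        wick_psum[OF wick_d2[OF wick_d2[OF w]] converges_d2[OF c2] tx(2,1)]
        power_mult_distrib algebra_simps)
  also have "\<dots> = 0"
    using zmc_op_complex[OF c zmc, of "\<i> * of_real x" t] tx by (simp add: norm_mult)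
  finally show "(1 - (psum (d1 (e \<circ> prod.swap)) t x)\<^sup>2) * psum (d2 (d2 (e \<circ> prod.swap))) t x
      + 2 * psum (d1 (e \<circ> prod.swap)) t x * psum (d2 (e \<circ> prod.swap)) t x * psum (d2 (d1 (e \<circ> prod.swap))) t x
      - (1 + (psum (d2 (e \<circ> prod.swap)) t x)\<^sup>2) * psum (d1 (d1 (e \<circ> prod.swap))) t x = 0"
    unfolding d1_swap d2_swap psum_swap of_real_eq_0_iff .
qed

text \<open>
  With \<open>h(t,x) = -\<i> g(\<i>t,x)\<close> one has \<open>h\<^sub>t = g\<^sub>x\<close> and \<open>h\<^sub>x = -\<i> g\<^sub>y\<close>, and the Born-Infeld operator of
  \<open>h\<close> becomes \<open>-\<i>\<close> times the zero mean curvature operator of \<open>g\<close>.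
\<close>
lemma born_infeld_wick_odd:
  assumes w: "wick (- \<i>) c e" and c: "converges c r"
    and zmc: "\<And>x y :: real. \<bar>x\<bar> < r \<Longrightarrow> \<bar>y\<bar> < r \<Longrightarrow> zmc_op c x y = 0"
  shows "born_infeld_on (psum e) ({-r<..<r} \<times> {-r<..<r})"
proof (rule born_infeld_psum)
  show e: "converges e r" by (rule wick_converges[OF w c])
  fix t x :: real assume tx: "\<bar>t\<bar> < r" "\<bar>x\<bar> < r"
  note c1 = converges_d1[OF c] and c2 = converges_d2[OF c]
  have "complex_of_real ((1 - (psum (d1 e) t x)\<^sup>2) * psum (d2 (d2 e)) t x
      + 2 * psum (d1 e) t x * psum (d2 e) t x * psum (d2 (d1 e)) t x
      - (1 + (psum (d2 e) t x)\<^sup>2) * psum (d1 (d1 e)) t x)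
    = - \<i> * zmc_op c (\<i> * of_real t) (of_real x)"
    unfolding zmc_op_def
    by (simp add: wick_psum[OF wick_d2[OF w] c2 tx] wick_psum[OF wick_d1[OF w] c1 tx]
        wick_psum[OF wick_d1[OF wick_d1[OF w]] converges_d1[OF c1] tx]
        wick_psum[OF wick_d2[OF wick_d1[OF w]] converges_d2[OF c1] tx]
        wick_psum[OF wick_d2[OF wick_d2[OF w]] converges_d2[OF c2] tx]
        power_mult_distrib algebra_simps)
  also have "\<dots> = 0"
    using zmc_op_complex[OF c zmc, of "\<i> * of_real t" x] tx by (simp add: norm_mult)
  finally show "(1 - (psum (d1 e) t x)\<^sup>2) * psum (d2 (d2 e)) t x
      + 2 * psum (d1 e) t x * psum (d2 e) t x * psum (d2 (d1 e)) t x
      - (1 + (psum (d2 e) t x)\<^sup>2) * psum (d1 (d1 e)) t x = 0"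
    unfolding of_real_eq_0_iff .
qed

text \<open>
  On the axis \<open>h\<^sub>t = \<sigma>\<close> and \<open>h\<^sub>x = 0\<close>, so the tangent vector \<open>(1,0,\<sigma>)\<close> is null and orthogonal to the
  other one, \<open>(0,1,0)\<close>: the metric degenerates. Half of the axis inside the square is used so that
  the closed segment stays in the open domain.
\<close>
lemma lightlike_segment_on_axis:
  fixes \<sigma> :: real
  assumes e: "converges e r" and r: "r > 0" and \<sigma>: "\<sigma>\<^sup>2 = 1"
    and axis: "\<And>t. \<bar>t\<bar> < r \<Longrightarrow> psum e t 0 = \<sigma> * t" and flat: "\<And>t. \<bar>t\<bar> < r \<Longrightarrow> psum (d2 e) t 0 = 0"
  shows "\<exists>L. lightlike_line_segment (graph_y (psum e)) ({-r<..<r} \<times> {-r<..<r}) L \<and>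
    0 \<in> rel_interior L \<and> L \<subseteq> range (\<lambda>y. (\<sigma> * y, 0, y))"
proof -
  define a :: point where "a = (- (r / 2), 0, - (\<sigma> * (r / 2)))"
  define b :: point where "b = (r / 2, 0, \<sigma> * (r / 2))"
  have ab: "a \<noteq> b" using r by (auto simp: a_def b_def)
  have seg: "\<exists>t. \<bar>t\<bar> < r \<and> p = (t, 0, \<sigma> * t)" if "p \<in> closed_segment a b" for p
  proof -
    from that obtain u where u: "0 \<le> u" "u \<le> 1" "p = (1 - u) *\<^sub>R a + u *\<^sub>R b" by (auto simp: in_segment)
    have "\<bar>u - 1 / 2\<bar> \<le> 1 / 2" using u by arith
    then have "\<bar>(u - 1 / 2) * r\<bar> \<le> 1 / 2 * r"
      unfolding abs_mult using r by (intro mult_mono) auto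
    then have "\<bar>(u - 1 / 2) * r\<bar> < r" using r by linarith
    moreover have "p = ((u - 1 / 2) * r, 0, \<sigma> * ((u - 1 / 2) * r))"
      by (simp add: u(3) a_def b_def field_simps)
    ultimately show ?thesis by blast
  qed
  have steep: "psum (d1 e) t 0 = \<sigma>" if t: "\<bar>t\<bar> < r" for t
  proof -
    have "((\<lambda>t. psum e t 0) has_field_derivative psum (d1 e) t 0) (at t)"
      using psum_deriv1[OF e, of t 0] t r by simp
    moreover have "((\<lambda>t. psum e t 0) has_field_derivative \<sigma>) (at t)"
      by (rule has_field_derivative_transform_within_open[of "\<lambda>t. \<sigma> * t" _ _ "{-r<..<r}"])
        (use t axis in \<open>auto intro!: derivative_eq_intros\<close>)
    ultimately show ?thesis by (rule DERIV_unique)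
  qed
  have "lightlike_line_segment (graph_y (psum e)) ({-r<..<r} \<times> {-r<..<r}) (closed_segment a b)"
    unfolding lightlike_line_segment_def
  proof (intro conjI)
    have "lorentz (b - a) (b - a) = 0"
      using \<sigma> by (simp add: a_def b_def lorentz_def power2_eq_square)
    with ab show "\<exists>a' b'. a' \<noteq> b' \<and> lorentz (b' - a') (b' - a') = 0 \<and> closed_segment a b = closed_segment a' b'"
      by blast
    show "closed_segment a b \<subseteq> (\<lambda>(u, v). graph_y (psum e) u v) ` ({-r<..<r} \<times> {-r<..<r})"
    proof
      fix p assume "p \<in> closed_segment a b"
      from seg[OF this] obtain t where t: "\<bar>t\<bar> < r" "p = (t, 0, \<sigma> * t)" by blast
      then show "p \<in> (\<lambda>(u, v). graph_y (psum e) u v) ` ({-r<..<r} \<times> {-r<..<r})"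
        by (intro image_eqI[of _ _ "(t, 0)"]) (auto simp: graph_y_def axis)
    qed
    show "\<forall>(u, v)\<in>{-r<..<r} \<times> {-r<..<r}. graph_y (psum e) u v \<in> closed_segment a b \<longrightarrow>
        lightlike_at (graph_y (psum e)) u v"
    proof (intro ballI, clarify)
      fix t v assume "graph_y (psum e) t v \<in> closed_segment a b"
      from seg[OF this] have v: "v = 0" and t: "\<bar>t\<bar> < r" by (auto simp: graph_y_def)
      have "((\<lambda>s. psum e s 0) has_vector_derivative \<sigma>) (at t)"
        using psum_deriv1[OF e, of t 0] t r steep[OF t]
        by (simp add: has_real_derivative_iff_has_vector_derivative)
      then have t': "vector_derivative (\<lambda>s. graph_y (psum e) s 0) (at t) = (1, 0, \<sigma>)"
        unfolding graph_y_def
        by (intro vector_derivative_at has_vector_derivative_Pair) (auto intro!: derivative_eq_intros)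
      have "((\<lambda>s. psum e t s) has_vector_derivative 0) (at 0)"
        using psum_deriv2[OF e, of t 0] t r flat[OF t]
        by (simp add: has_real_derivative_iff_has_vector_derivative)
      then have v': "vector_derivative (\<lambda>s. graph_y (psum e) t s) (at 0) = (0, 1, 0)"
        unfolding graph_y_def
        by (intro vector_derivative_at has_vector_derivative_Pair) (auto intro!: derivative_eq_intros)
      show "lightlike_at (graph_y (psum e)) t v"
        using \<sigma> by (simp add: lightlike_at_def v t' v' lorentz_def power2_eq_square)
    qed
  qed
  moreover have "0 \<in> rel_interior (closed_segment a b)"
  proof -
    have "0 = (1 - 1 / 2) *\<^sub>R a + (1 / 2) *\<^sub>R b" by (simp add: a_def b_def zero_prod_def)
    then have "0 \<in> open_segment a b" using ab unfolding in_segment by (intro conjI exI[of _ "1 / 2"]) auto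
    then show ?thesis using ab by (simp add: rel_interior_closed_segment)
  qed
  moreover have "closed_segment a b \<subseteq> range (\<lambda>y. (\<sigma> * y, 0, y))"
  proof
    fix p assume "p \<in> closed_segment a b"
    from seg[OF this] obtain t where "p = (t, 0, \<sigma> * t)" by blast
    then have "p = (\<sigma> * (\<sigma> * t), 0, \<sigma> * t)"
      using \<sigma> by (simp add: mult.assoc[symmetric] power2_eq_square)
    then show "p \<in> range (\<lambda>y. (\<sigma> * y, 0, y))" by blast
  qed
  ultimately show ?thesis by blast
qed

lemma null_segment_through_origin:
  assumes L: "lightlike_line_segment X D L" and 0: "0 \<in> rel_interior L"
  obtains d \<epsilon> where "lorentz d d = 0" "d \<noteq> 0" "\<epsilon> > 0"
    "L \<subseteq> range (\<lambda>s. s *\<^sub>R d)" "\<And>s. \<bar>s\<bar> < \<epsilon> \<Longrightarrow> s *\<^sub>R d \<in> L"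
proof -
  from L obtain a b where ab: "a \<noteq> b" "lorentz (b - a) (b - a) = 0" "L = closed_segment a b"
    unfolding lightlike_line_segment_def by blast
  from 0 have "0 \<in> open_segment a b" using ab by (simp add: rel_interior_closed_segment)
  then obtain u where u: "0 < u" "u < 1" "0 = (1 - u) *\<^sub>R a + u *\<^sub>R b" by (auto simp: in_segment)
  have a: "a = (- u) *\<^sub>R (b - a)" using u(3) by (simp add: algebra_simps)
  have pt: "(1 - w) *\<^sub>R a + w *\<^sub>R b = (w - u) *\<^sub>R (b - a)" for w
  proof -
    have "(1 - w) *\<^sub>R a + w *\<^sub>R b = a + w *\<^sub>R (b - a)" by (simp add: algebra_simps)
    also have "\<dots> = (w - u) *\<^sub>R (b - a)" by (subst (1) a) (simp add: scaleR_left_diff_distrib)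
    finally show ?thesis .
  qed
  show ?thesis
  proof (rule that[OF ab(2)])
    show "b - a \<noteq> 0" "min u (1 - u) > 0" using ab u by auto
    show "L \<subseteq> range (\<lambda>s. s *\<^sub>R (b - a))"
    proof
      fix p assume "p \<in> L"
      then obtain w where "p = (1 - w) *\<^sub>R a + w *\<^sub>R b" unfolding ab(3) in_segment by blast
      then show "p \<in> range (\<lambda>s. s *\<^sub>R (b - a))" unfolding pt by blast
    qed
    show "s *\<^sub>R (b - a) \<in> L" if "\<bar>s\<bar> < min u (1 - u)" for s
      unfolding ab(3) in_segment using that pt[of "s + u"] by (intro exI[of _ "s + u"]) auto
  qed
qed

section \<open>The zero mean curvature graph at the origin\<close>
lemma double_series_at_origin:
  assumes "real_analytic2_on g D" and "open D" and "(0, 0) \<in> D"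
  obtains c r where "r > 0" "converges c r" "{-r<..<r} \<times> {-r<..<r} \<subseteq> D"
    "\<And>x y. \<bar>x\<bar> < r \<Longrightarrow> \<bar>y\<bar> < r \<Longrightarrow> g x y = psum c x y"
proof -
  from assms obtain r0 c where r0: "r0 > 0" and c: "\<And>u v. \<bar>u\<bar> < r0 \<Longrightarrow> \<bar>v\<bar> < r0 \<Longrightarrow>
      ((\<lambda>(m, n). c (m, n) * u ^ m * v ^ n) has_sum g u v) UNIV"
    unfolding real_analytic2_on_def by fastforce
  obtain A B where AB: "open A" "open B" "0 \<in> A" "0 \<in> B" "A \<times> B \<subseteq> D"
    using open_prod_elim[OF assms(2,3)] by (metis mem_Sigma_iff)
  then have "open (A \<inter> B)" "0 \<in> A \<inter> B" by auto
  then obtain r1 where r1: "r1 > 0" "ball 0 r1 \<subseteq> A \<inter> B" using open_contains_ball by blast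
  show ?thesis
  proof (rule that[of "min r0 r1" c])
    show "min r0 r1 > 0" using r0 r1 by simp
    show "converges c (min r0 r1)"
      unfolding converges_def
    proof (intro allI impI)
      fix x y assume xy: "0 \<le> x" "x < min r0 r1" "0 \<le> y" "y < min r0 r1"
      have "(\<lambda>(m, n). c (m, n) * x ^ m * y ^ n) summable_on UNIV"
        by (rule has_sum_imp_summable[OF c]) (use xy in auto)
      then have "(\<lambda>p. norm (case p of (m, n) \<Rightarrow> c (m, n) * x ^ m * y ^ n)) summable_on UNIV"
        by (subst (asm) summable_on_iff_abs_summable_on_real)
      then show "(\<lambda>(m, n). \<bar>c (m, n)\<bar> * x ^ m * y ^ n) summable_on UNIV"
        using xy by (simp add: case_prod_unfold abs_mult)
    qed
    show "{-min r0 r1<..<min r0 r1} \<times> {-min r0 r1<..<min r0 r1} \<subseteq> D"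
    proof
      fix p assume "p \<in> {-min r0 r1<..<min r0 r1} \<times> {-min r0 r1<..<min r0 r1}"
      then have "fst p \<in> ball 0 r1" "snd p \<in> ball 0 r1" by (auto simp: abs_less_iff)
      then have "p \<in> A \<times> B" using r1(2) by (simp add: mem_Times_iff subset_iff)
      then show "p \<in> D" using AB(5) by blast
    qed
    show "g x y = psum c x y" if "\<bar>x\<bar> < min r0 r1" "\<bar>y\<bar> < min r0 r1" for x y
      using psumI[of c x y "g x y"] c[of x y] that by simp
  qed
qed

lemma zmc_op_eq_0:
  assumes zmc: "zero_mean_curvature_on g D" and D: "{-r<..<r} \<times> {-r<..<r} \<subseteq> D"
    and c: "converges c r" and g: "\<And>x y. \<bar>x\<bar> < r \<Longrightarrow> \<bar>y\<bar> < r \<Longrightarrow> g x y = psum c x y"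
    and xy: "\<bar>x\<bar> < r" "\<bar>y\<bar> < r"
  shows "zmc_op c x y = 0"
proof -
  note p1 = pd1_eq_psum[OF c g] and p2 = pd2_eq_psum[OF c g]
  note p11 = pd1_eq_psum[OF converges_d1[OF c] p1]
    and p12 = pd2_eq_psum[OF converges_d1[OF c] p1]
    and p22 = pd2_eq_psum[OF converges_d2[OF c] p2]
  have "(x, y) \<in> D" using xy D by (auto simp: abs_less_iff)
  then show ?thesis
    using zmc unfolding zero_mean_curvature_on_def zmc_op_def
    by (auto simp: p1[OF _ _ xy] p2[OF _ _ xy] p11[OF _ _ _ _ xy] p12[OF _ _ _ _ xy] p22[OF _ _ _ _ xy])
qed

lemma lightlike_gradient:
  assumes ll: "lightlike_at (graph_t g) x y"
    and c: "converges c r" and g: "\<And>x y. \<bar>x\<bar> < r \<Longrightarrow> \<bar>y\<bar> < r \<Longrightarrow> g x y = psum c x y"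
    and xy: "\<bar>x\<bar> < r" "\<bar>y\<bar> < r"
  shows "(psum (d1 c) x y)\<^sup>2 + (psum (d2 c) x y)\<^sup>2 = 1"
proof -
  have "((\<lambda>s. g s y) has_field_derivative psum (d1 c) x y) (at x)"
    by (rule has_field_derivative_transform_within_open[OF psum_deriv1[OF c], of _ _ "{-r<..<r}"])
      (use xy g in auto)
  then have "(\<lambda>s. g s y) differentiable (at x)" by (auto simp: real_differentiable_def)
  moreover have "((\<lambda>s. g x s) has_field_derivative psum (d2 c) x y) (at y)"
    by (rule has_field_derivative_transform_within_open[OF psum_deriv2[OF c], of _ _ "{-r<..<r}"])
      (use xy g in auto)
  then have "(\<lambda>s. g x s) differentiable (at y)" by (auto simp: real_differentiable_def)
  ultimately have "B g x y = 0" using ll lightlike_at_graph_t_iff by blast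
  then show ?thesis
    using pd1_eq_psum[OF c g xy] pd2_eq_psum[OF c g xy] by (simp add: B_def)
qed

text \<open>
  Differentiating \<open>g(sp, sq) = s\<tau>\<close> at \<open>s = 0\<close>. The size conditions only restrict \<open>s\<close> to a
  neighbourhood of \<open>0\<close>.
\<close>
lemma gradient_along_segment:
  assumes c: "converges c r" and r: "r > 0" and \<epsilon>: "\<epsilon> > 0"
    and line: "\<And>s. \<bar>s\<bar> < \<epsilon> \<Longrightarrow> \<bar>s * p\<bar> < r \<Longrightarrow> \<bar>s * q\<bar> < r \<Longrightarrow> psum c (s * p) (s * q) = s * \<tau>"
  shows "psum (d1 c) 0 0 * p + psum (d2 c) 0 0 * q = (\<tau> :: real)"
proof -
  have "((\<lambda>s. psum c (s * p) (s * q)) has_field_derivative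
      psum (d1 c) (0 * p) (0 * q) * p + psum (d2 c) (0 * p) (0 * q) * q) (at 0)"
    by (rule psum_chain[OF c]; use r in \<open>auto intro!: derivative_eq_intros\<close>)
  moreover have "((\<lambda>s. psum c (s * p) (s * q)) has_field_derivative \<tau>) (at 0)"
  proof (rule has_field_derivative_transform_within_open)
    show "((\<lambda>s. s * \<tau>) has_field_derivative \<tau>) (at 0)" by (auto intro!: derivative_eq_intros)
    show "open ({-\<epsilon><..<\<epsilon>} \<inter> (\<lambda>s. s * p) -` {-r<..<r} \<inter> (\<lambda>s. s * q) -` {-r<..<r})"
      by (intro open_Int open_vimage continuous_intros)
    show "0 \<in> {-\<epsilon><..<\<epsilon>} \<inter> (\<lambda>s. s * p) -` {-r<..<r} \<inter> (\<lambda>s. s * q) -` {-r<..<r}"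
      using r \<epsilon> by auto
    show "s * \<tau> = psum c (s * p) (s * q)"
      if "s \<in> {-\<epsilon><..<\<epsilon>} \<inter> (\<lambda>s. s * p) -` {-r<..<r} \<inter> (\<lambda>s. s * q) -` {-r<..<r}" for s
      using that by (intro line[symmetric]) (auto simp: abs_less_iff)
  qed
  ultimately show ?thesis using DERIV_unique by fastforce
qed

section \<open>The two Wick rotations\<close>

text \<open>
  The sign in \<open>f\<^sub>x\<^sub>x(0,y) = - H\<^sub>x\<^sub>x(y,0)\<close> cancels against \<open>\<i>\<^sup>2 = -1\<close> from the two rotated
  \<open>x\<close>-derivatives, whence \<open>\<alpha>\<^sub>h = \<alpha>\<^sub>g\<close>.
\<close>
lemma even_wick_rotation:
  assumes c: "converges c r" and r: "r > 0"
    and g: "\<And>x y. \<bar>x\<bar> < r \<Longrightarrow> \<bar>y\<bar> < r \<Longrightarrow> g x y = psum c x y"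
    and zmc: "\<And>x y :: real. \<bar>x\<bar> < r \<Longrightarrow> \<bar>y\<bar> < r \<Longrightarrow> zmc_op c x y = 0"
    and even: "\<And>m n. odd m \<Longrightarrow> c (m, n) = 0"
    and \<sigma>: "\<sigma>\<^sup>2 = (1 :: real)" and axis: "\<And>y. \<bar>y\<bar> < r \<Longrightarrow> psum c 0 y = \<sigma> * y"
    and flat: "\<And>y :: real. \<bar>y\<bar> < r \<Longrightarrow> psum (d1 c) 0 y = 0"
  shows "\<exists>h f L'. let U = {- r<..<r} \<times> {- r<..<r} in
    wick_even_on g h U \<and> real_analytic2_on h U \<and> born_infeld_on h U \<and>
    lightlike_line_segment (graph_y h) U L' \<and> 0 \<in> rel_interior L' \<and> L' \<subseteq> range (\<lambda>y. (\<sigma> * y, 0, y)) \<and>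
    rewritten_as_t_graph (\<lambda>t x. \<sigma> * h t x) f \<and>
    (\<forall>\<^sub>F s in nhds 0. approx_fun f s = approx_fun (\<lambda>x y. \<sigma> * g x y) s)"
proof -
  define b where "b = wick_coeffs c"
  define e where "e = b \<circ> prod.swap"
  have w: "wick 1 c b" unfolding b_def by (rule wick_wick_coeffs_even) (rule even)
  have b: "converges b r" by (rule wick_converges[OF w c])
  have e: "converges e r" unfolding e_def by (rule converges_swap[OF b])
  have b_axis: "psum b 0 t = \<sigma> * t" if t: "\<bar>t\<bar> < r" for t
  proof -
    have "complex_of_real (psum b 0 t) = psum c (of_real 0) (of_real t)"
      using wick_psum[OF w c, of 0 t] t r by simp
    also have "\<dots> = of_real (\<sigma> * t)"
      using axis[OF t] t r by (subst psum_of_real[OF c]) auto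
    finally show ?thesis unfolding of_real_eq_iff .
  qed
  have b_flat: "psum (d1 b) 0 t = 0" if t: "\<bar>t\<bar> < r" for t
  proof -
    have "complex_of_real (psum (d1 b) 0 t) = \<i> * psum (d1 c) (of_real 0) (of_real t)"
      using wick_psum[OF wick_d1[OF w] converges_d1[OF c], of 0 t] t r by simp
    also have "\<dots> = 0"
      using flat[OF t] t r by (subst psum_of_real[OF converges_d1[OF c]]) auto
    finally show ?thesis unfolding of_real_eq_0_iff .
  qed
  have e_axis: "psum e t 0 = \<sigma> * t" and e_flat: "psum (d2 e) t 0 = 0" if "\<bar>t\<bar> < r" for t
    using b_axis[OF that] b_flat[OF that] by (simp_all add: e_def d2_swap psum_swap)
  let ?e = "\<lambda>p. \<sigma> * e p"
  have \<sigma>e: "psum ?e = (\<lambda>t x :: real. \<sigma> * psum e t x)" by (simp add: psum_cmult fun_eq_iff)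
  obtain f s where s: "s > 0" and f: "rewritten_as_t_graph (psum ?e) f"
    and df: "\<And>y. \<bar>y\<bar> < s \<Longrightarrow> ((\<lambda>x. pd1 f x y) has_field_derivative - psum (d2 (d2 ?e)) y 0) (at 0)"
  proof (rule implicit_t_graph[OF converges_cmult[OF e] r])
    show "psum ?e t 0 = t" if "\<bar>t\<bar> < r" for t
      using e_axis[OF that] \<sigma> by (simp add: \<sigma>e power2_eq_square)
    show "psum (d2 ?e) t 0 = 0" if "\<bar>t\<bar> < r" for t
      using e_flat[OF that] by (simp add: d2_cmult psum_cmult)
  qed blast
  obtain L' where L': "lightlike_line_segment (graph_y (psum e)) ({-r<..<r} \<times> {-r<..<r}) L'"
    "0 \<in> rel_interior L'" "L' \<subseteq> range (\<lambda>y. (\<sigma> * y, 0, y))"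
    using lightlike_segment_on_axis[OF e r \<sigma> e_axis e_flat] by auto
  have "wick_even_on g (psum e) ({-r<..<r} \<times> {-r<..<r})"
    unfolding wick_even_on_def
  proof (intro ballI, clarify, intro conjI)
    fix t x assume "t \<in> {-r<..<r}" "x \<in> {-r<..<r}"
    then have tx: "\<bar>t\<bar> < r" "\<bar>x\<bar> < r" "norm (\<i> * complex_of_real x) < r"
      by (auto simp: norm_mult)
    note T = taylor_ext_psum[OF c tx(3,1), of "\<lambda>s. g s t", OF g[OF _ tx(1)]]
    show "taylor_summable (\<lambda>s. g s t) (\<i> * complex_of_real x)" by (rule T)
    show "complex_of_real (psum e t x) = taylor_ext (\<lambda>s. g s t) (\<i> * complex_of_real x)"
      using T(2) wick_psum[OF w c tx(2,1)] by (simp add: e_def psum_swap)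
  qed
  moreover have "\<forall>\<^sub>F s in nhds 0. approx_fun f s = approx_fun (\<lambda>x y. \<sigma> * g x y) s"
  proof -
    let ?c = "\<lambda>p. \<sigma> * c p"
    have G: "(\<lambda>x y. \<sigma> * g x y) x y = psum ?c x y" if "\<bar>x\<bar> < r" "\<bar>y\<bar> < r" for x y
      using g[OF that] by (simp add: psum_cmult)
    note c' = converges_cmult[OF c, of \<sigma>]
    have "\<forall>\<^sub>F y in nhds 0. y \<in> {- min r s<..<min r s}"
      using r s by (intro eventually_nhds_in_open) auto
    then show ?thesis
    proof eventually_elim
      case (elim y)
      then have y: "\<bar>y\<bar> < r" "\<bar>y\<bar> < s" "\<bar>0::real\<bar> < r" using r by auto
      have "approx_fun (\<lambda>x y. \<sigma> * g x y) y = psum (d1 (d1 ?c)) 0 y"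
        unfolding approx_fun_def
        by (rule pd1_eq_psum[OF converges_d1[OF c'] pd1_eq_psum[OF c' G] y(3,1)])
      also have "\<dots> = \<sigma> * psum (d1 (d1 c)) 0 y" by (simp add: d1_cmult psum_cmult)
      finally have g': "approx_fun (\<lambda>x y. \<sigma> * g x y) y = \<sigma> * psum (d1 (d1 c)) 0 y" .
      have "complex_of_real (psum (d1 (d1 b)) 0 y) = - psum (d1 (d1 c)) (of_real 0) (of_real y)"
        using wick_psum[OF wick_d1[OF wick_d1[OF w]] converges_d1[OF converges_d1[OF c]] y(3,1)] by simp
      also have "\<dots> = of_real (- psum (d1 (d1 c)) 0 y)"
        by (subst psum_of_real[OF converges_d1[OF converges_d1[OF c]] y(3,1)]) simp
      finally have "psum (d1 (d1 b)) 0 y = - psum (d1 (d1 c)) 0 y" unfolding of_real_eq_iff .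
      moreover have "approx_fun f y = - psum (d2 (d2 ?e)) y 0"
        unfolding approx_fun_def pd1_def[of "pd1 f"] by (rule DERIV_imp_deriv[OF df[OF y(2)]])
      moreover have "psum (d2 (d2 e)) y 0 = psum (d1 (d1 b)) 0 y"
        by (simp add: e_def d2_swap psum_swap)
      ultimately show ?case
        by (simp add: g' d2_cmult psum_cmult)
    qed
  qed
  ultimately show ?thesis
    unfolding Let_def using L' f[unfolded \<sigma>e] real_analytic2_on_psum[OF e] born_infeld_wick_even[OF w c zmc]
    by - (rule exI[of _ "psum e"], rule exI[of _ f], rule exI[of _ L'], simp add: e_def)
qed

text \<open>
  Here \<open>x\<close>, the direction of the line, is rotated. The values on the axis at imaginary points
  are therefore obtained by continuation along the axis rather than read off at \<open>0\<close>. The second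
  derivative is taken in the other variable, so only the phase \<open>-\<i>\<close> and the sign from
  \<open>f\<^sub>x\<^sub>x(0,y) = - H\<^sub>x\<^sub>x(y,0)\<close> remain: \<open>\<alpha>\<^sub>h(s) = \<i> \<alpha>\<^sub>g(\<i>s)\<close>. The Riccati constant changes sign since
  \<open>\<alpha>\<^sub>h'(s) = - \<alpha>\<^sub>g'(\<i>s) = \<alpha>\<^sub>g(\<i>s)\<^sup>2 + \<mu> = - \<alpha>\<^sub>h(s)\<^sup>2 + \<mu>\<close>.
\<close>
lemma odd_wick_rotation:
  assumes c: "converges c r" and r: "r > 0"
    and g: "\<And>x y. \<bar>x\<bar> < r \<Longrightarrow> \<bar>y\<bar> < r \<Longrightarrow> g x y = psum c x y"
    and zmc: "\<And>x y :: real. \<bar>x\<bar> < r \<Longrightarrow> \<bar>y\<bar> < r \<Longrightarrow> zmc_op c x y = 0"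
    and odd: "\<And>m n. even m \<Longrightarrow> c (m, n) = 0"
    and \<sigma>: "\<sigma>\<^sup>2 = (1 :: real)" and axis: "\<And>x. \<bar>x\<bar> < r \<Longrightarrow> psum c x 0 = \<sigma> * x"
    and flat: "\<And>x :: real. \<bar>x\<bar> < r \<Longrightarrow> psum (d2 c) x 0 = 0"
  shows "\<exists>h f L'. let U = {- r<..<r} \<times> {- r<..<r};
             G = (\<lambda>y x. \<sigma> * g x y);
             \<alpha>\<^sub>g = approx_fun G;
             \<alpha>\<^sub>h = approx_fun f
         in wick_odd_on g h U \<and>
            real_analytic2_on h U \<and> born_infeld_on h U \<and>
            lightlike_line_segment (graph_y h) U L' \<and> 0 \<in> rel_interior L' \<and>
            L' \<subseteq> range (\<lambda>y. (\<sigma> * y, 0, y)) \<and>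
            rewritten_as_t_graph (\<lambda>t x. \<sigma> * h t x) f \<and>
            (\<forall>\<^sub>F s in nhds 0.
               taylor_summable \<alpha>\<^sub>g (\<i> * complex_of_real s) \<and>
               complex_of_real (\<alpha>\<^sub>h s) = \<i> * taylor_ext \<alpha>\<^sub>g (\<i> * complex_of_real s)) \<and>
            odd_near_0 \<alpha>\<^sub>g \<and> odd_near_0 \<alpha>\<^sub>h \<and>
            (of_type G alpha_plus \<or> of_type G alpha_zero_I \<or> of_type G alpha_minus_I) \<and>
            (of_type f alpha_plus \<or> of_type f alpha_zero_I \<or> of_type f alpha_minus_I) \<and>
            (of_type G alpha_plus \<longrightarrow> of_type f alpha_minus_I) \<and>
            (of_type G alpha_minus_I \<longrightarrow> of_type f alpha_plus) \<and>
            (of_type G alpha_zero_I \<longrightarrow> of_type f alpha_zero_I)"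
proof -
  define e where "e = wick_coeffs c"
  let ?c = "\<lambda>p. \<sigma> * c p" and ?e = "\<lambda>p. \<sigma> * e p"
  define a where "a = d2 (d2 ?c)"
  define b where "b = d2 (d2 ?e)"
  have w: "wick (- \<i>) c e" unfolding e_def by (rule wick_wick_coeffs_odd) (rule odd)
  have w': "wick (- \<i>) ?c ?e" by (rule wick_cmult[OF w])
  have wab: "wick (- \<i>) a b" unfolding a_def b_def by (intro wick_d2 w')
  have e: "converges e r" by (rule wick_converges[OF w c])
  have c': "converges ?c r" and e': "converges ?e r" by (intro converges_cmult c e)+
  have a: "converges a r" and b: "converges b r" unfolding a_def b_def by (intro converges_d2 c' e')+
  have r0: "\<bar>0::real\<bar> < r" "norm (0::complex) < r" using r by auto
  have axis': "psum ?c x 0 = x" if "\<bar>x\<bar> < r" for x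
    using axis[OF that] \<sigma> by (simp add: psum_cmult power2_eq_square)
  have flat': "psum (d2 ?c) x 0 = 0" if "\<bar>x\<bar> < r" for x :: real
    using flat[OF that] by (simp add: psum_cmult d2_cmult)
  have e_axis': "psum ?e t 0 = t" if t: "\<bar>t\<bar> < r" for t
  proof -
    have "psum ?c z 0 - z = 0" if z: "norm z < r" for z :: complex
    proof (rule holomorphic_vanishing[OF _ _ z])
      show "(\<lambda>z. psum ?c z 0 - z) holomorphic_on ball 0 r"
        by (intro holomorphic_intros psum_holomorphic[OF c' r0(2)])
      show "psum ?c (complex_of_real x) 0 - complex_of_real x = 0" if x: "\<bar>x\<bar> < r" for x
        using psum_of_real[OF c' x r0(1), where 'a = complex] axis'[OF x] by simp
    qed
    from this[of "\<i> * of_real t"] have "complex_of_real (psum ?e t 0) = of_real t"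
      using wick_psum[OF w' c' t r0(1)] t by (simp add: norm_mult)
    then show ?thesis unfolding of_real_eq_iff .
  qed
  have e_flat': "psum (d2 ?e) t 0 = 0" if t: "\<bar>t\<bar> < r" for t
  proof -
    have "psum (d2 ?c) z 0 = 0" if z: "norm z < r" for z :: complex
    proof (rule holomorphic_vanishing[OF _ _ z])
      show "(\<lambda>z. psum (d2 ?c) z 0) holomorphic_on ball 0 r"
        by (intro psum_holomorphic[OF converges_d2[OF c'] r0(2)])
      show "psum (d2 ?c) (complex_of_real x) 0 = 0" if x: "\<bar>x\<bar> < r" for x
        using psum_of_real[OF converges_d2[OF c'] x r0(1), where 'a = complex] flat'[OF x] by simp
    qed
    from this[of "\<i> * of_real t"] have "complex_of_real (psum (d2 ?e) t 0) = 0"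
      using wick_psum[OF wick_d2[OF w'] converges_d2[OF c'] t r0(1)] t by (simp add: norm_mult)
    then show ?thesis unfolding of_real_eq_0_iff .
  qed
  have \<sigma>\<sigma>: "\<sigma> * (\<sigma> * x) = x" for x using \<sigma> by (simp add: mult.assoc[symmetric] power2_eq_square)
  have \<sigma>e: "psum ?e = (\<lambda>t x :: real. \<sigma> * psum e t x)" by (simp add: psum_cmult fun_eq_iff)
  have e_axis: "psum e t 0 = \<sigma> * t" and e_flat: "psum (d2 e) t 0 = 0" if "\<bar>t\<bar> < r" for t
    using e_axis'[OF that] e_flat'[OF that] \<sigma> \<sigma>\<sigma>[of "psum e t 0"]
    by (auto simp: psum_cmult d2_cmult)
  obtain f s where s: "s > 0" and f: "rewritten_as_t_graph (psum ?e) f"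
    and df: "\<And>y. \<bar>y\<bar> < s \<Longrightarrow> ((\<lambda>x. pd1 f x y) has_field_derivative - psum b y 0) (at 0)"
    unfolding b_def
  proof (rule implicit_t_graph[OF e' r])
    show "psum ?e t 0 = t" "psum (d2 ?e) t 0 = 0" if "\<bar>t\<bar> < r" for t
      using e_axis'[OF that] e_flat'[OF that] .
  qed blast
  obtain L' where L': "lightlike_line_segment (graph_y (psum e)) ({-r<..<r} \<times> {-r<..<r}) L'"
    "0 \<in> rel_interior L'" "L' \<subseteq> range (\<lambda>y. (\<sigma> * y, 0, y))"
    using lightlike_segment_on_axis[OF e r \<sigma> e_axis e_flat] by auto
  have wick: "wick_odd_on g (psum e) ({-r<..<r} \<times> {-r<..<r})"
    unfolding wick_odd_on_def
  proof (intro ballI, clarify, intro conjI)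
    fix t x assume "t \<in> {-r<..<r}" "x \<in> {-r<..<r}"
    then have tx: "\<bar>t\<bar> < r" "\<bar>x\<bar> < r" "norm (\<i> * complex_of_real t) < r"
      by (auto simp: norm_mult)
    note T = taylor_ext_psum[OF c tx(3,2), of "\<lambda>s. g s x", OF g[OF _ tx(2)]]
    show "taylor_summable (\<lambda>s. g s x) (\<i> * complex_of_real t)" by (rule T)
    show "complex_of_real (psum e t x) = - \<i> * taylor_ext (\<lambda>s. g s x) (\<i> * complex_of_real t)"
      using T(2) wick_psum[OF w c tx(1,2)] by simp
  qed
  define G where "G = (\<lambda>y x. \<sigma> * g x y)"
  have G: "G y x = psum (?c \<circ> prod.swap) y x" if "\<bar>y\<bar> < r" "\<bar>x\<bar> < r" for x y
    using g[OF that(2,1)] by (simp add: G_def psum_swap psum_cmult)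
  note cs = converges_swap[OF c']
  have dG: "((\<lambda>y. pd1 G y x) has_field_derivative psum a x 0) (at 0)" if x: "\<bar>x\<bar> < r" for x
  proof (rule has_field_derivative_transform_within_open)
    show "((\<lambda>y. psum (d1 (?c \<circ> prod.swap)) y x) has_field_derivative psum a x 0) (at 0)"
      using psum_deriv1[OF converges_d1[OF cs], of 0 x] x r0 by (simp add: d1_swap psum_swap a_def)
    show "psum (d1 (?c \<circ> prod.swap)) y x = pd1 G y x" if "y \<in> {-r<..<r}" for y
      using that x by (intro pd1_eq_psum[OF cs G, symmetric]) auto
  qed (use r in auto)
  have \<alpha>g: "approx_fun G x = psum a x 0" if "\<bar>x\<bar> < r" for x
    unfolding approx_fun_def pd1_def[of "pd1 G"] by (rule DERIV_imp_deriv[OF dG[OF that]])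
  have \<alpha>h: "approx_fun f x = - psum b x 0" if "\<bar>x\<bar> < s" for x
    unfolding approx_fun_def pd1_def[of "pd1 f"] by (rule DERIV_imp_deriv[OF df[OF that]])
  have rot: "complex_of_real (- psum b x 0) = \<i> * psum a (\<i> * of_real x) 0" if x: "\<bar>x\<bar> < r" for x
    using wick_psum[OF wab a x r0(1)] by simp
  have near: "\<forall>\<^sub>F x in nhds 0. \<bar>x\<bar> < r \<and> \<bar>x\<bar> < s"
  proof -
    have "\<forall>\<^sub>F x in nhds 0. x \<in> {- min r s<..<min r s}"
      using r s by (intro eventually_nhds_in_open) auto
    then show ?thesis by eventually_elim auto
  qed
  from near have taylor: "\<forall>\<^sub>F x in nhds 0. taylor_summable (approx_fun G) (\<i> * complex_of_real x) \<and>
      complex_of_real (approx_fun f x) = \<i> * taylor_ext (approx_fun G) (\<i> * complex_of_real x)"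
  proof eventually_elim
    case (elim x)
    then have x: "\<bar>x\<bar> < r" "\<bar>x\<bar> < s" and ix: "norm (\<i> * complex_of_real x) < r" by (auto simp: norm_mult)
    note T = taylor_ext_psum[OF a ix r0(1) \<alpha>g]
    show ?case using T \<alpha>h[OF x(2)] rot[OF x(1)] by simp
  qed
  have a_odd: "psum a (- x) 0 = - psum a x 0" and b_odd: "psum b (- x) 0 = - psum b x 0" for x :: real
    by (rule psum_odd; simp add: a_def b_def d2_def e_def wick_coeffs_def odd)+
  from near have odd_g: "odd_near_0 (approx_fun G)"
    unfolding odd_near_0_def by eventually_elim (simp add: \<alpha>g a_odd)
  from near have odd_h: "odd_near_0 (approx_fun f)"
    unfolding odd_near_0_def by eventually_elim (simp add: \<alpha>h b_odd)
  have zmc': "zmc_op ?c x y = 0" if "\<bar>x\<bar> < r" "\<bar>y\<bar> < r" for x y :: real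
  proof -
    have "zmc_op ?c x y = \<sigma> * zmc_op c x y"
      using \<sigma> by (simp add: zmc_op_def d1_cmult d2_cmult psum_cmult power_mult_distrib
          algebra_simps power2_eq_square \<sigma>\<sigma>)
    then show ?thesis using zmc[OF that] by simp
  qed
  obtain \<mu> where \<mu>: "\<And>x. \<bar>x\<bar> < r \<Longrightarrow> psum (d1 a) x 0 = - ((psum a x 0)\<^sup>2 + \<mu>)"
    using riccati_along_axis[OF c' zmc' axis' flat'] unfolding a_def by blast
  \<comment> \<open>The Riccati equation at \<open>\<i>x\<close>, from which the one for \<open>\<alpha>\<^sub>h\<close> follows.\<close>
  have \<mu>_complex: "psum (d1 a) z 0 + (psum a z 0)\<^sup>2 + of_real \<mu> = 0" if z: "norm z < r" for z :: complex
  proof (rule holomorphic_vanishing[OF _ _ z])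
    show "(\<lambda>z. psum (d1 a) z 0 + (psum a z 0)\<^sup>2 + of_real \<mu>) holomorphic_on ball 0 r"
      by (intro holomorphic_intros psum_holomorphic[OF a r0(2)] psum_holomorphic[OF converges_d1[OF a] r0(2)])
    show "psum (d1 a) (complex_of_real x) 0 + (psum a (complex_of_real x) 0)\<^sup>2 + of_real \<mu> = 0"
      if x: "\<bar>x\<bar> < r" for x
    proof -
      have "psum (d1 a) (complex_of_real x) 0 = of_real (psum (d1 a) x 0)"
        "psum a (complex_of_real x) 0 = of_real (psum a x 0)"
        using psum_of_real[OF converges_d1[OF a] x r0(1), where 'a = complex]
          psum_of_real[OF a x r0(1), where 'a = complex] by simp_all
      then show ?thesis using \<mu>[OF x] by simp
    qed
  qed
  have ode_g: "((\<lambda>x. psum a x 0) has_field_derivative - ((psum a x 0)\<^sup>2 + \<mu>)) (at x)"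
    if "\<bar>x\<bar> < r" for x
    using psum_deriv1[OF a, of x 0] that r \<mu>[OF that] by simp
  have ode_h: "((\<lambda>x. - psum b x 0) has_field_derivative - ((- psum b x 0)\<^sup>2 + - \<mu>)) (at x)"
    if x: "\<bar>x\<bar> < r" for x
  proof -
    let ?z = "\<i> * complex_of_real x"
    have "complex_of_real (- psum (d1 b) x 0) = - psum (d1 a) ?z 0"
      using wick_psum[OF wick_d1[OF wab] converges_d1[OF a] x r0(1)] by simp
    also have "\<dots> = (psum a ?z 0)\<^sup>2 + of_real \<mu>"
      using \<mu>_complex[of ?z] x by (simp add: norm_mult add_eq_0_iff2 algebra_simps)
    also have "(psum a ?z 0)\<^sup>2 = - (of_real (- psum b x 0))\<^sup>2"
      unfolding rot[OF x] by (simp add: power_mult_distrib)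
    also have "- (of_real (- psum b x 0))\<^sup>2 + complex_of_real \<mu> = of_real (- ((- psum b x 0)\<^sup>2 + - \<mu>))" by simp
    finally have "- psum (d1 b) x 0 = - ((- psum b x 0)\<^sup>2 + - \<mu>)" unfolding of_real_eq_iff .
    moreover have "((\<lambda>x. - psum b x 0) has_field_derivative - psum (d1 b) x 0) (at x)"
      using psum_deriv1[OF b, of x 0] x r by (intro DERIV_minus) simp
    ultimately show ?thesis by simp
  qed
  have zero: "psum a 0 (0::real) = 0" "- psum b 0 (0::real) = 0" using a_odd[of 0] b_odd[of 0] by simp_all
  have type_g: "of_type G alpha_plus \<longleftrightarrow> \<mu> > 0" "of_type G alpha_zero_I \<longleftrightarrow> \<mu> = 0"
    "of_type G alpha_minus_I \<longleftrightarrow> \<mu> < 0"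
    using of_type_alpha_plus_iff[OF r dG ode_g zero(1)] of_type_alpha_zero_I_iff[OF r dG ode_g zero(1)]
      of_type_alpha_minus_I_iff[OF r dG ode_g zero(1)] by auto
  have m: "min r s > 0" using r s by simp
  have type_h: "of_type f alpha_plus \<longleftrightarrow> - \<mu> > 0" "of_type f alpha_zero_I \<longleftrightarrow> - \<mu> = 0"
    "of_type f alpha_minus_I \<longleftrightarrow> - \<mu> < 0"
    using of_type_alpha_plus_iff[OF m df ode_h zero(2)] of_type_alpha_zero_I_iff[OF m df ode_h zero(2)]
      of_type_alpha_minus_I_iff[OF m df ode_h zero(2)] by auto
  have types: "(of_type G alpha_plus \<or> of_type G alpha_zero_I \<or> of_type G alpha_minus_I) \<and>
      (of_type f alpha_plus \<or> of_type f alpha_zero_I \<or> of_type f alpha_minus_I) \<and>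
      (of_type G alpha_plus \<longrightarrow> of_type f alpha_minus_I) \<and>
      (of_type G alpha_minus_I \<longrightarrow> of_type f alpha_plus) \<and>
      (of_type G alpha_zero_I \<longrightarrow> of_type f alpha_zero_I)"
    unfolding type_g type_h by linarith
  have bi: "born_infeld_on (psum e) ({-r<..<r} \<times> {-r<..<r})"
    by (rule born_infeld_wick_odd[OF w c]) (rule zmc)
  show ?thesis
    unfolding Let_def G_def[symmetric]
    by (rule exI[of _ "psum e"], rule exI[of _ f], rule exI[of _ L'])
      (intro conjI[OF wick] conjI[OF real_analytic2_on_psum[OF e]] conjI[OF bi] conjI[OF L'(1)] conjI[OF L'(2)]
        conjI[OF L'(3)] conjI[OF f[unfolded \<sigma>e]] conjI[OF taylor] conjI[OF odd_g] conjI[OF odd_h] types)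
qed

theorem theorem4p5:
  fixes g :: "real \<Rightarrow> real \<Rightarrow> real" and D :: "(real \<times> real) set" and L :: "point set"
  assumes "open D" and "connected D" and "(0, 0) \<in> D"
    and "\<forall>(x, y) \<in> D. (- x, y) \<in> D"
    and "real_analytic2_on g D"
    and "zero_mean_curvature_on g D"
    and "g 0 0 = 0"
    and "lightlike_at (graph_t g) 0 0"
    and "pd1 (B g) 0 0 = 0" and "pd2 (B g) 0 0 = 0"
    and "lightlike_line_segment (graph_t g) D L" and "0 \<in> rel_interior L"
  shows
    "((\<forall>(x, y) \<in> D. g (- x) y = g x y) \<longrightarrow>
      (\<exists>\<sigma> \<in> {1, - 1}. \<exists>r > 0. \<exists>h f L'.
         let U = {- r<..<r} \<times> {- r<..<r};
             \<alpha>\<^sub>g = approx_fun (\<lambda>x y. \<sigma> * g x y);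
             \<alpha>\<^sub>h = approx_fun f
         in L \<subseteq> range (\<lambda>y. (\<sigma> * y, 0, y)) \<and>
            wick_even_on g h U \<and>
            real_analytic2_on h U \<and> born_infeld_on h U \<and>
            lightlike_line_segment (graph_y h) U L' \<and> 0 \<in> rel_interior L' \<and>
            L' \<subseteq> range (\<lambda>y. (\<sigma> * y, 0, y)) \<and>
            rewritten_as_t_graph (\<lambda>t x. \<sigma> * h t x) f \<and>
            (\<forall>\<^sub>F s in nhds 0. \<alpha>\<^sub>h s = \<alpha>\<^sub>g s)))
     \<and>
     ((\<forall>(x, y) \<in> D. g (- x) y = - g x y) \<longrightarrow>
      (\<exists>\<sigma> \<in> {1, - 1}. \<exists>r > 0. \<exists>h f L'.
         let U = {- r<..<r} \<times> {- r<..<r};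
             G = (\<lambda>y x. \<sigma> * g x y);
             \<alpha>\<^sub>g = approx_fun G;
             \<alpha>\<^sub>h = approx_fun f
         in L \<subseteq> range (\<lambda>x. (\<sigma> * x, x, 0)) \<and>
            wick_odd_on g h U \<and>
            real_analytic2_on h U \<and> born_infeld_on h U \<and>
            lightlike_line_segment (graph_y h) U L' \<and> 0 \<in> rel_interior L' \<and>
            L' \<subseteq> range (\<lambda>y. (\<sigma> * y, 0, y)) \<and>
            rewritten_as_t_graph (\<lambda>t x. \<sigma> * h t x) f \<and>
            (\<forall>\<^sub>F s in nhds 0.
               taylor_summable \<alpha>\<^sub>g (\<i> * complex_of_real s) \<and>
               complex_of_real (\<alpha>\<^sub>h s) = \<i> * taylor_ext \<alpha>\<^sub>g (\<i> * complex_of_real s)) \<and>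
            odd_near_0 \<alpha>\<^sub>g \<and> odd_near_0 \<alpha>\<^sub>h \<and>
            (of_type G alpha_plus \<or> of_type G alpha_zero_I \<or> of_type G alpha_minus_I) \<and>
            (of_type f alpha_plus \<or> of_type f alpha_zero_I \<or> of_type f alpha_minus_I) \<and>
            (of_type G alpha_plus \<longrightarrow> of_type f alpha_minus_I) \<and>
            (of_type G alpha_minus_I \<longrightarrow> of_type f alpha_plus) \<and>
            (of_type G alpha_zero_I \<longrightarrow> of_type f alpha_zero_I)))"
proof -
  note D = assms(1,3) and analytic = assms(5) and zmc = assms(6)
    and lightlike = assms(8) and L = assms(11,12)
  obtain c r0 where r0: "r0 > 0" and c0: "converges c r0" and D0: "{-r0<..<r0} \<times> {-r0<..<r0} \<subseteq> D"
    and g0: "\<And>x y. \<bar>x\<bar> < r0 \<Longrightarrow> \<bar>y\<bar> < r0 \<Longrightarrow> g x y = psum c x y"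
    by (rule double_series_at_origin[OF analytic D]) blast
  obtain d \<epsilon> where d: "lorentz d d = 0" "d \<noteq> 0" and \<epsilon>: "\<epsilon> > 0"
    and L_range: "L \<subseteq> range (\<lambda>s. s *\<^sub>R d)" and L_pt: "\<And>s. \<bar>s\<bar> < \<epsilon> \<Longrightarrow> s *\<^sub>R d \<in> L"
    by (rule null_segment_through_origin[OF L]) blast
  obtain \<tau> p q where d_eq: "d = (\<tau>, p, q)" by (metis prod.exhaust)
  have null: "\<tau>\<^sup>2 = p\<^sup>2 + q\<^sup>2" using d(1) by (simp add: d_eq lorentz_def power2_eq_square)
  then have \<tau>: "\<tau> \<noteq> 0" using d(2) by (auto simp: d_eq zero_prod_def)
  have on_L: "g (s * p) (s * q) = s * \<tau> \<and> (s * p, s * q) \<in> D \<and> lightlike_at (graph_t g) (s * p) (s * q)"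
    if s: "\<bar>s\<bar> < \<epsilon>" for s
  proof -
    have sub: "L \<subseteq> (\<lambda>(u, v). graph_t g u v) ` D"
      and ll: "\<And>u v. (u, v) \<in> D \<Longrightarrow> graph_t g u v \<in> L \<Longrightarrow> lightlike_at (graph_t g) u v"
      using L(1) unfolding lightlike_line_segment_def by auto
    from L_pt[OF s] sub obtain u v where uv: "(u, v) \<in> D" "s *\<^sub>R d = graph_t g u v" by fastforce
    then have "u = s * p" "v = s * q" "g u v = s * \<tau>" by (auto simp: d_eq graph_t_def)
    with uv ll[OF uv(1)] L_pt[OF s] show ?thesis by auto
  qed
  define P Q where "P = psum (d1 c) 0 (0::real)" and "Q = psum (d2 c) 0 (0::real)"
  have "P * p + Q * q = \<tau>"
    unfolding P_def Q_def
  proof (rule gradient_along_segment[OF c0 r0 \<epsilon>])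
    show "psum c (s * p) (s * q) = s * \<tau>" if "\<bar>s\<bar> < \<epsilon>" "\<bar>s * p\<bar> < r0" "\<bar>s * q\<bar> < r0" for s
      using on_L[OF that(1)] g0[OF that(2,3)] by simp
  qed
  moreover have "P\<^sup>2 + Q\<^sup>2 = 1"
    unfolding P_def Q_def by (rule lightlike_gradient[OF lightlike c0 g0]) (use r0 in auto)
  ultimately have grad: "P * p + Q * q = \<tau>" "P\<^sup>2 + Q\<^sup>2 = 1" by auto
  \<comment> \<open>For \<open>\<bar>t\<bar> < r\<close> the parameter \<open>t / \<tau>\<close> stays below \<open>\<epsilon>\<close>, so the point with time coordinate \<open>t\<close>
      on the line spanned by \<open>(\<tau>,p,q)\<close> lies on \<open>L\<close>.\<close>
  define r where "r = min r0 (\<epsilon> * \<bar>\<tau>\<bar>)"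
  have r: "r > 0" "r \<le> r0" using r0 \<epsilon> \<tau> by (auto simp: r_def)
  have c: "converges c r" by (rule converges_smaller[OF c0 r(2)])
  have Dr: "{-r<..<r} \<times> {-r<..<r} \<subseteq> D" using D0 r(2) by fastforce
  have g: "g x y = psum c x y" if "\<bar>x\<bar> < r" "\<bar>y\<bar> < r" for x y
    using that r(2) by (intro g0) auto
  have zero: "zmc_op c x y = 0" if "\<bar>x\<bar> < r" "\<bar>y\<bar> < r" for x y :: real
    using zmc_op_eq_0[OF zmc Dr c g that] .
  have small: "\<bar>t / \<tau>\<bar> < \<epsilon>" if "\<bar>t\<bar> < r" for t
    using that \<tau> by (auto simp: r_def abs_divide field_simps)
  have parity: "(- 1) ^ m * c (m, n) = k * c (m, n)" if "\<forall>(x, y) \<in> D. g (- x) y = k * g x y" for m n k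
  proof (rule psum_parity[OF c r(1)])
    show "psum c (- x) y = k * psum c x y" if "\<bar>x\<bar> < r" "\<bar>y\<bar> < r" for x y
    proof -
      have "(x, y) \<in> D" using that Dr by (auto simp: abs_less_iff)
      then have "g (- x) y = k * g x y" using \<open>\<forall>(x, y) \<in> D. g (- x) y = k * g x y\<close> by blast
      then show ?thesis using g[of x y] g[of "- x" y] that by simp
    qed
  qed
  show ?thesis
  proof (intro conjI impI)
    assume "\<forall>(x, y) \<in> D. g (- x) y = g x y"
    then have even: "c (m, n) = 0" if "odd m" for m n
      using parity[of 1 m n] that by simp
    have flat: "psum (d1 c) 0 y = 0" if y: "\<bar>y\<bar> < r" for y :: real
    proof -
      have "psum (d1 c) (- 0) y = - psum (d1 c) 0 y"
        by (rule psum_odd) (simp add: d1_def even)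
      then show ?thesis by simp
    qed
    define \<sigma> where "\<sigma> = Q"
    have \<sigma>: "\<sigma>\<^sup>2 = 1" "\<sigma> * q = \<tau>" using grad flat[of 0] r(1) by (auto simp: P_def \<sigma>_def)
    have p: "p = 0"
    proof -
      have "\<tau>\<^sup>2 = q\<^sup>2" using \<sigma> by (metis mult_1 power_mult_distrib)
      then show ?thesis using null by simp
    qed
    have q: "q = \<sigma> * \<tau>" using \<sigma> by (metis mult.assoc mult_1 power2_eq_square)
    have axis: "psum c 0 y = \<sigma> * y" if y: "\<bar>y\<bar> < r" for y
    proof -
      have sy: "\<bar>\<sigma> * y\<bar> < r" using y \<sigma>(1) by (auto simp: power2_eq_1_iff)
      have "g 0 (\<sigma> * y / \<tau> * q) = \<sigma> * y / \<tau> * \<tau>"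
        using on_L[OF small[OF sy]] by (simp add: p)
      moreover have "\<sigma> * y / \<tau> * q = y"
        using \<sigma>(1) \<tau> by (auto simp: q power2_eq_1_iff)
      ultimately show ?thesis using g[of 0 y] y r(1) \<tau> by simp
    qed
    have "L \<subseteq> range (\<lambda>y. (\<sigma> * y, 0, y))"
    proof
      fix z assume "z \<in> L"
      then obtain s where "z = s *\<^sub>R d" using L_range by auto
      then have "z = (\<sigma> * (s * q), 0, s * q)" using \<sigma>(2) by (auto simp: d_eq p)
      then show "z \<in> range (\<lambda>y. (\<sigma> * y, 0, y))" by blast
    qed
    moreover have "\<sigma> \<in> {1, - 1}" using \<sigma>(1) by (simp add: power2_eq_1_iff)
    moreover note even_wick_rotation[OF c r(1) g zero even \<sigma>(1) axis flat]
    ultimately show "\<exists>\<sigma> \<in> {1, - 1}. \<exists>r > 0. \<exists>h f L'.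
         let U = {- r<..<r} \<times> {- r<..<r};
             \<alpha>\<^sub>g = approx_fun (\<lambda>x y. \<sigma> * g x y);
             \<alpha>\<^sub>h = approx_fun f
         in L \<subseteq> range (\<lambda>y. (\<sigma> * y, 0, y)) \<and>
            wick_even_on g h U \<and>
            real_analytic2_on h U \<and> born_infeld_on h U \<and>
            lightlike_line_segment (graph_y h) U L' \<and> 0 \<in> rel_interior L' \<and>
            L' \<subseteq> range (\<lambda>y. (\<sigma> * y, 0, y)) \<and>
            rewritten_as_t_graph (\<lambda>t x. \<sigma> * h t x) f \<and>
            (\<forall>\<^sub>F s in nhds 0. \<alpha>\<^sub>h s = \<alpha>\<^sub>g s)"
      using r(1) unfolding Let_def by blast
  next
    assume "\<forall>(x, y) \<in> D. g (- x) y = - g x y"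
    then have odd: "c (m, n) = 0" if "even m" for m n
      using parity[of "- 1" m n] that by simp
    have flat0: "Q = 0"
    proof -
      have "psum (d2 c) (- 0) (0::real) = - psum (d2 c) 0 0"
        by (rule psum_odd) (simp add: d2_def odd)
      then show ?thesis by (simp add: Q_def)
    qed
    define \<sigma> where "\<sigma> = P"
    have \<sigma>: "\<sigma>\<^sup>2 = 1" "\<sigma> * p = \<tau>" using grad flat0 by (auto simp: \<sigma>_def)
    have q: "q = 0"
    proof -
      have "\<tau>\<^sup>2 = p\<^sup>2" using \<sigma> by (metis mult_1 power_mult_distrib)
      then show ?thesis using null by simp
    qed
    have p: "p = \<sigma> * \<tau>" using \<sigma> by (metis mult.assoc mult_1 power2_eq_square)
    have on_axis: "psum c x 0 = \<sigma> * x \<and> lightlike_at (graph_t g) x 0" if x: "\<bar>x\<bar> < r" for x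
    proof -
      have sx: "\<bar>\<sigma> * x\<bar> < r" using x \<sigma>(1) by (auto simp: power2_eq_1_iff)
      have *: "\<sigma> * x / \<tau> * p = x"
        using \<sigma>(1) \<tau> by (auto simp: p power2_eq_1_iff)
      have "g (\<sigma> * x / \<tau> * p) 0 = \<sigma> * x / \<tau> * \<tau> \<and> lightlike_at (graph_t g) (\<sigma> * x / \<tau> * p) 0"
        using on_L[OF small[OF sx]] by (simp add: q)
      then show ?thesis using g[of x 0] x r(1) \<tau> unfolding * by simp
    qed
    then have axis: "psum c x 0 = \<sigma> * x" if "\<bar>x\<bar> < r" for x using that by blast
    have flat: "psum (d2 c) x 0 = 0" if x: "\<bar>x\<bar> < r" for x
    proof -
      have "((\<lambda>x. psum c x 0) has_field_derivative psum (d1 c) x 0) (at x)"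
        using psum_deriv1[OF c, of x 0] x r(1) by simp
      moreover have "((\<lambda>x. psum c x 0) has_field_derivative \<sigma>) (at x)"
        by (rule has_field_derivative_transform_within_open[of "\<lambda>x. \<sigma> * x" _ _ "{-r<..<r}"])
          (use x axis in \<open>auto intro!: derivative_eq_intros\<close>)
      ultimately have "psum (d1 c) x 0 = \<sigma>" by (rule DERIV_unique)
      moreover have "(psum (d1 c) x 0)\<^sup>2 + (psum (d2 c) x 0)\<^sup>2 = 1"
        by (rule lightlike_gradient[OF _ c g]) (use on_axis[OF x] x r(1) in auto)
      ultimately show ?thesis using \<sigma>(1) by simp
    qed
    have "L \<subseteq> range (\<lambda>x. (\<sigma> * x, x, 0))"
    proof
      fix z assume "z \<in> L"
      then obtain s where "z = s *\<^sub>R d" using L_range by auto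
      then have "z = (\<sigma> * (s * p), s * p, 0)" using \<sigma>(2) by (auto simp: d_eq q)
      then show "z \<in> range (\<lambda>x. (\<sigma> * x, x, 0))" by blast
    qed
    moreover have "\<sigma> \<in> {1, - 1}" using \<sigma>(1) by (simp add: power2_eq_1_iff)
    moreover note odd_wick_rotation[OF c r(1) g zero odd \<sigma>(1) axis flat]
    ultimately show "\<exists>\<sigma> \<in> {1, - 1}. \<exists>r > 0. \<exists>h f L'.
         let U = {- r<..<r} \<times> {- r<..<r};
             G = (\<lambda>y x. \<sigma> * g x y);
             \<alpha>\<^sub>g = approx_fun G;
             \<alpha>\<^sub>h = approx_fun f
         in L \<subseteq> range (\<lambda>x. (\<sigma> * x, x, 0)) \<and>
            wick_odd_on g h U \<and>
            real_analytic2_on h U \<and> born_infeld_on h U \<and>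
            lightlike_line_segment (graph_y h) U L' \<and> 0 \<in> rel_interior L' \<and>
            L' \<subseteq> range (\<lambda>y. (\<sigma> * y, 0, y)) \<and>
            rewritten_as_t_graph (\<lambda>t x. \<sigma> * h t x) f \<and>
            (\<forall>\<^sub>F s in nhds 0.
               taylor_summable \<alpha>\<^sub>g (\<i> * complex_of_real s) \<and>
               complex_of_real (\<alpha>\<^sub>h s) = \<i> * taylor_ext \<alpha>\<^sub>g (\<i> * complex_of_real s)) \<and>
            odd_near_0 \<alpha>\<^sub>g \<and> odd_near_0 \<alpha>\<^sub>h \<and>
            (of_type G alpha_plus \<or> of_type G alpha_zero_I \<or> of_type G alpha_minus_I) \<and>
            (of_type f alpha_plus \<or> of_type f alpha_zero_I \<or> of_type f alpha_minus_I) \<and>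
            (of_type G alpha_plus \<longrightarrow> of_type f alpha_minus_I) \<and>
            (of_type G alpha_minus_I \<longrightarrow> of_type f alpha_plus) \<and>
            (of_type G alpha_zero_I \<longrightarrow> of_type f alpha_zero_I)"
      using r(1) unfolding Let_def by blast
  qed
qed

end
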